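(* Let $(E,\varphi)$ be a product system of graphs over a countable semigroup $P$ with identity $e$, and let $X(E):=\bigcup_{p\in P}X(E_p)$, where $X(E_p)$ is the Cuntz-Krieger bimodule of the graph $E_p$. Then there is a unique associative multiplication on $X(E)$ such that for all $\lambda,\mu\in E^1$ $$\delta_\lambda\delta_\mu=\begin{cases}\delta_{\lambda\mu}&\text{if }(\lambda,\mu)\in(E_{d(\lambda)}\times_{E^0}E_{d(\mu)})^1\\0&\text{otherwise},\end{cases}$$ and $X(E)$ thus becomes a product system over $P$ of Hilbert bimodules over $C_0(E^0)$.
   Context: **Product systems of graphs.** A (directed) graph $(E^0,E^1,r,s)$ has countable vertex set $E^0$, countable edge set $E^1$ and range and source maps $r,s:E^1\to E^0$. For graphs $E,F$ with the same vertex set $E^0$, $E\times_{E^0}F$ is the graph with vertex set $E^0$, edge set $(E\times_{E^0}F)^1=\{(\lambda,\mu):\lambda\in E^1,\mu\in F^1,r(\lambda)=s(\mu)\}$, $s(\lambda,\mu)=s(\lambda)$, $r(\lambda,\mu)=r(\mu)$. A product system $(E,\varphi)$ of graphs over $P$ consists of graphs $E_p=(E^0,E_p^1,r_p,s_p)$, $p\in P$, with common vertex set $E^0$ and disjoint edge sets, and graph isomorphisms $\varphi_{p,q}:E_p\times_{E^0}E_q\to E_{pq}$ (identity on vertices), $p,q\in P$, with $\varphi_{pq,r}(\varphi_{p,q}(\lambda,\mu),\nu)=\varphi_{p,qr}(\lambda,\varphi_{q,r}(\mu,\nu))$ for all $p,q,r\in P$, $(\lambda,\mu)\in(E_p\times_{E^0}E_q)^1$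 and $(\mu,\nu)\in(E_q\times_{E^0}E_r)^1$, and $E_e=(E^0,E^0,\mathrm{id},\mathrm{id})$. Put $E^1:=\bigcup_pE_p^1$, $d(\lambda)=p$ if $\lambda\in E_p^1$, and $\lambda\mu:=\varphi_{p,q}(\lambda,\mu)$ for $(\lambda,\mu)\in(E_p\times_{E^0}E_q)^1$. **Cuntz-Krieger bimodule.** A Hilbert bimodule over a $C^*$-algebra $A$ is a right Hilbert $A$-module with a left action of $A$ by adjointable operators. For a graph $E$, $X(E)$ is the set of functions $x:E^1\to\mathbb{C}$ such that $v\mapsto\sum_{r(\lambda)=v}|x(\lambda)|^2$ is finite and vanishes at infinity on $E^0$; it is a Hilbert bimodule over $C_0(E^0)$ with $(x\cdot a)(\lambda)=x(\lambda)a(r(\lambda))$, $(a\cdot x)(\lambda)=a(s(\lambda))x(\lambda)$, $\langle x,y\rangle(v)=\sum_{r(\lambda)=v}\overline{x(\lambda)}y(\lambda)$. For $\lambda\in E_p^1$, $\delta_\lambda\in X(E_p)$ is the point mass at $\lambda$. Note $X(E_e)=C_0(E^0)$. **Product systems of Hilbert bimodules (Fowler).** A product system over $P$ of Hilbert bimodules over $A$ is a semigroup $X=\bigsqcup_{p\in P}X_p$ where each $X_p$ is a Hilbert bimodule over $A$, $X_e=A$, $X_pX_q\subset X_{pq}$, for $p,q\in P\setminus\{e\}$ the map $(x,y)\mapsto xy$ extends to an isomorphism $X_p\otimes_AX_q\to X_{pq}$ of Hilbert bimodules, and for $a\in A=X_e$, $x\in X_p$ one has $ax=a\cdot x$ and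 $xa=x\cdot a$.
   Formalization: Uniqueness is proved among multiplications that make X(E) a product system of Hilbert bimodules and satisfy the delta rule; among bare associative multiplications it fails (for P={e} and one vertex, the complex numbers carry many associative operations with 1·1=1). *)

theory Defs
  imports
    "HOL-Analysis.Analysis"
    "HOL-Library.Function_Algebras"
    "HOL-Library.Poly_Mapping"
    "Graph_Theory.Digraph"
begin

section \<open>C*-algebras and Hilbert bimodules\<close>

text \<open>
  Algebras and bimodules are given by carrier sets, all axioms being relative to the carrier.
  Addition and multiplication of an algebra are those of the ambient type, which need not have
  a unit.
\<close>

record 'a star_algebra =
  alg :: "'a set"
  ascale :: "complex \<Rightarrow> 'a \<Rightarrow> 'a"
  astar :: "'a \<Rightarrow> 'a"
  anorm :: "'a \<Rightarrow> real"

definition cauchy_wrt :: "('x \<Rightarrow> 'x \<Rightarrow> real) \<Rightarrow> (nat \<Rightarrow> 'x) \<Rightarrow> bool" where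
  "cauchy_wrt d \<sigma> \<longleftrightarrow> (\<forall>\<epsilon>>0. \<exists>N. \<forall>m\<ge>N. \<forall>n\<ge>N. d (\<sigma> m) (\<sigma> n) < \<epsilon>)"

definition complete_wrt :: "('x \<Rightarrow> 'x \<Rightarrow> real) \<Rightarrow> 'x set \<Rightarrow> bool" where
  "complete_wrt d S \<longleftrightarrow>
    (\<forall>\<sigma>. range \<sigma> \<subseteq> S \<and> cauchy_wrt d \<sigma> \<longrightarrow> (\<exists>x\<in>S. (\<lambda>n. d (\<sigma> n) x) \<longlonglongrightarrow> 0))"

locale cstar_algebra =
  fixes A :: "('a::ring) star_algebra"
  assumes zero_closed: "0 \<in> alg A"
    and add_closed: "\<lbrakk>a \<in> alg A; b \<in> alg A\<rbrakk> \<Longrightarrow> a + b \<in> alg A"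
    and mult_closed: "\<lbrakk>a \<in> alg A; b \<in> alg A\<rbrakk> \<Longrightarrow> a * b \<in> alg A"
    and scale_closed: "a \<in> alg A \<Longrightarrow> ascale A c a \<in> alg A"
    and star_closed: "a \<in> alg A \<Longrightarrow> astar A a \<in> alg A"
    and scale_add_right: "\<lbrakk>a \<in> alg A; b \<in> alg A\<rbrakk> \<Longrightarrow> ascale A c (a + b) = ascale A c a + ascale A c b"
    and scale_add_left: "a \<in> alg A \<Longrightarrow> ascale A (c + c') a = ascale A c a + ascale A c' a"
    and scale_scale: "a \<in> alg A \<Longrightarrow> ascale A c (ascale A c' a) = ascale A (c * c') a"
    and scale_one: "a \<in> alg A \<Longrightarrow> ascale A 1 a = a"
    and scale_mult_left: "\<lbrakk>a \<in> alg A; b \<in> alg A\<rbrakk> \<Longrightarrow> ascale A c a * b = ascale A c (a * b)"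
    and scale_mult_right: "\<lbrakk>a \<in> alg A; b \<in> alg A\<rbrakk> \<Longrightarrow> a * ascale A c b = ascale A c (a * b)"
    and star_add: "\<lbrakk>a \<in> alg A; b \<in> alg A\<rbrakk> \<Longrightarrow> astar A (a + b) = astar A a + astar A b"
    and star_scale: "a \<in> alg A \<Longrightarrow> astar A (ascale A c a) = ascale A (cnj c) (astar A a)"
    and star_mult: "\<lbrakk>a \<in> alg A; b \<in> alg A\<rbrakk> \<Longrightarrow> astar A (a * b) = astar A b * astar A a"
    and star_star: "a \<in> alg A \<Longrightarrow> astar A (astar A a) = a"
    and norm_nonneg: "a \<in> alg A \<Longrightarrow> 0 \<le> anorm A a"
    and norm_eq_zero: "a \<in> alg A \<Longrightarrow> anorm A a = 0 \<longleftrightarrow> a = 0"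
    and norm_scale: "a \<in> alg A \<Longrightarrow> anorm A (ascale A c a) = cmod c * anorm A a"
    and norm_triangle: "\<lbrakk>a \<in> alg A; b \<in> alg A\<rbrakk> \<Longrightarrow> anorm A (a + b) \<le> anorm A a + anorm A b"
    and norm_mult: "\<lbrakk>a \<in> alg A; b \<in> alg A\<rbrakk> \<Longrightarrow> anorm A (a * b) \<le> anorm A a * anorm A b"
    and cstar_identity: "a \<in> alg A \<Longrightarrow> anorm A (astar A a * a) = (anorm A a)\<^sup>2"
    and complete: "complete_wrt (\<lambda>a b. anorm A (a - b)) (alg A)"

definition apositive :: "('a::ring) star_algebra \<Rightarrow> 'a \<Rightarrow> bool" where
  "apositive A a \<longleftrightarrow> (\<exists>b\<in>alg A. a = astar A b * b)"

record ('a, 'x) bimodule =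
  bcarrier :: "'x set"
  badd :: "'x \<Rightarrow> 'x \<Rightarrow> 'x"
  bzero :: "'x"
  bscale :: "complex \<Rightarrow> 'x \<Rightarrow> 'x"
  bright :: "'x \<Rightarrow> 'a \<Rightarrow> 'x"
  bleft :: "'a \<Rightarrow> 'x \<Rightarrow> 'x"
  binner :: "'x \<Rightarrow> 'x \<Rightarrow> 'a"

definition bdist :: "('a::ring) star_algebra \<Rightarrow> ('a, 'x) bimodule \<Rightarrow> 'x \<Rightarrow> 'x \<Rightarrow> real" where
  "bdist A X x y =
    (let z = badd X x (bscale X (-1) y) in sqrt (anorm A (binner X z z)))"

text \<open>
  The inner product is conjugate linear in the first variable. The last axiom says that \<open>a\<close> acts
  on the left by an adjointable operator with adjoint the action of \<open>a\<^sup>*\<close>; this forces the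
  operator to be linear, right \<open>A\<close>-linear and bounded.
\<close>

locale hilbert_bimodule = cstar_algebra A
  for A :: "('a::ring) star_algebra" +
  fixes X :: "('a, 'x) bimodule"
  assumes badd_closed: "\<lbrakk>x \<in> bcarrier X; y \<in> bcarrier X\<rbrakk> \<Longrightarrow> badd X x y \<in> bcarrier X"
    and bzero_closed: "bzero X \<in> bcarrier X"
    and bscale_closed: "x \<in> bcarrier X \<Longrightarrow> bscale X c x \<in> bcarrier X"
    and badd_assoc: "\<lbrakk>x \<in> bcarrier X; y \<in> bcarrier X; z \<in> bcarrier X\<rbrakk>
      \<Longrightarrow> badd X (badd X x y) z = badd X x (badd X y z)"
    and badd_commute: "\<lbrakk>x \<in> bcarrier X; y \<in> bcarrier X\<rbrakk> \<Longrightarrow> badd X x y = badd X y x"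
    and badd_zero: "x \<in> bcarrier X \<Longrightarrow> badd X x (bzero X) = x"
    and badd_minus: "x \<in> bcarrier X \<Longrightarrow> badd X x (bscale X (-1) x) = bzero X"
    and bscale_add_right: "\<lbrakk>x \<in> bcarrier X; y \<in> bcarrier X\<rbrakk>
      \<Longrightarrow> bscale X c (badd X x y) = badd X (bscale X c x) (bscale X c y)"
    and bscale_add_left: "x \<in> bcarrier X
      \<Longrightarrow> bscale X (c + c') x = badd X (bscale X c x) (bscale X c' x)"
    and bscale_scale: "x \<in> bcarrier X \<Longrightarrow> bscale X c (bscale X c' x) = bscale X (c * c') x"
    and bscale_one: "x \<in> bcarrier X \<Longrightarrow> bscale X 1 x = x"
    and bright_closed: "\<lbrakk>x \<in> bcarrier X; a \<in> alg A\<rbrakk> \<Longrightarrow> bright X x a \<in> bcarrier X"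
    and bright_add_left: "\<lbrakk>x \<in> bcarrier X; y \<in> bcarrier X; a \<in> alg A\<rbrakk>
      \<Longrightarrow> bright X (badd X x y) a = badd X (bright X x a) (bright X y a)"
    and bright_add_right: "\<lbrakk>x \<in> bcarrier X; a \<in> alg A; b \<in> alg A\<rbrakk>
      \<Longrightarrow> bright X x (a + b) = badd X (bright X x a) (bright X x b)"
    and bright_scale_left: "\<lbrakk>x \<in> bcarrier X; a \<in> alg A\<rbrakk>
      \<Longrightarrow> bright X (bscale X c x) a = bscale X c (bright X x a)"
    and bright_scale_right: "\<lbrakk>x \<in> bcarrier X; a \<in> alg A\<rbrakk>
      \<Longrightarrow> bright X x (ascale A c a) = bscale X c (bright X x a)"
    and bright_mult: "\<lbrakk>x \<in> bcarrier X; a \<in> alg A; b \<in> alg A\<rbrakk>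
      \<Longrightarrow> bright X x (a * b) = bright X (bright X x a) b"
    and binner_closed: "\<lbrakk>x \<in> bcarrier X; y \<in> bcarrier X\<rbrakk> \<Longrightarrow> binner X x y \<in> alg A"
    and binner_add: "\<lbrakk>x \<in> bcarrier X; y \<in> bcarrier X; z \<in> bcarrier X\<rbrakk>
      \<Longrightarrow> binner X x (badd X y z) = binner X x y + binner X x z"
    and binner_scale: "\<lbrakk>x \<in> bcarrier X; y \<in> bcarrier X\<rbrakk>
      \<Longrightarrow> binner X x (bscale X c y) = ascale A c (binner X x y)"
    and binner_right: "\<lbrakk>x \<in> bcarrier X; y \<in> bcarrier X; a \<in> alg A\<rbrakk>
      \<Longrightarrow> binner X x (bright X y a) = binner X x y * a"
    and binner_star: "\<lbrakk>x \<in> bcarrier X; y \<in> bcarrier X\<rbrakk>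
      \<Longrightarrow> astar A (binner X x y) = binner X y x"
    and binner_positive: "x \<in> bcarrier X \<Longrightarrow> apositive A (binner X x x)"
    and binner_definite: "\<lbrakk>x \<in> bcarrier X; binner X x x = 0\<rbrakk> \<Longrightarrow> x = bzero X"
    and bcomplete: "complete_wrt (bdist A X) (bcarrier X)"
    and bleft_closed: "\<lbrakk>a \<in> alg A; x \<in> bcarrier X\<rbrakk> \<Longrightarrow> bleft X a x \<in> bcarrier X"
    and bleft_add: "\<lbrakk>a \<in> alg A; b \<in> alg A; x \<in> bcarrier X\<rbrakk>
      \<Longrightarrow> bleft X (a + b) x = badd X (bleft X a x) (bleft X b x)"
    and bleft_scale: "\<lbrakk>a \<in> alg A; x \<in> bcarrier X\<rbrakk>
      \<Longrightarrow> bleft X (ascale A c a) x = bscale X c (bleft X a x)"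
    and bleft_mult: "\<lbrakk>a \<in> alg A; b \<in> alg A; x \<in> bcarrier X\<rbrakk>
      \<Longrightarrow> bleft X (a * b) x = bleft X a (bleft X b x)"
    and bleft_adjoint: "\<lbrakk>a \<in> alg A; x \<in> bcarrier X; y \<in> bcarrier X\<rbrakk>
      \<Longrightarrow> binner X (bleft X a x) y = binner X x (bleft X (astar A a) y)"

definition self_bimodule :: "('a::ring) star_algebra \<Rightarrow> ('a, 'a) bimodule" where
  "self_bimodule A = \<lparr>bcarrier = alg A, badd = (+), bzero = 0, bscale = ascale A,
     bright = (*), bleft = (*), binner = (\<lambda>a b. astar A a * b)\<rparr>"

definition bimodule_iso ::
  "'a star_algebra \<Rightarrow> ('a, 'x) bimodule \<Rightarrow> ('a, 'y) bimodule \<Rightarrow> ('x \<Rightarrow> 'y) \<Rightarrow> bool" where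
  "bimodule_iso A X Y U \<longleftrightarrow>
     bij_betw U (bcarrier X) (bcarrier Y) \<and>
     (\<forall>x\<in>bcarrier X. \<forall>y\<in>bcarrier X. U (badd X x y) = badd Y (U x) (U y)) \<and>
     (\<forall>c. \<forall>x\<in>bcarrier X. U (bscale X c x) = bscale Y c (U x)) \<and>
     (\<forall>x\<in>bcarrier X. \<forall>a\<in>alg A. U (bright X x a) = bright Y (U x) a) \<and>
     (\<forall>x\<in>bcarrier X. \<forall>a\<in>alg A. U (bleft X a x) = bleft Y a (U x)) \<and>
     (\<forall>x\<in>bcarrier X. \<forall>y\<in>bcarrier X. binner Y (U x) (U y) = binner X x y)"


section \<open>The balanced tensor product\<close>

text \<open>
  \<open>X \<otimes>\<^sub>A Y\<close> is the separated completion of the algebraic tensor product in the \<open>A\<close>-valued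
  semi-inner product with \<open>\<langle>x \<otimes> y, x' \<otimes> y'\<rangle> = \<langle>y, \<langle>x, x'\<rangle> \<cdot> y'\<rangle>\<close>. We start from the free
  complex vector space on \<open>X \<times> Y\<close> instead of the algebraic tensor product: the bilinearity
  and balancing relations have length zero, so they are divided out with the other null vectors.
  Elements of the completion are classes of Cauchy sequences.
\<close>

definition free_carrier :: "('a, 'x) bimodule \<Rightarrow> ('a, 'y) bimodule \<Rightarrow> ('x \<times> 'y \<Rightarrow>\<^sub>0 complex) set"
  where "free_carrier X Y = {f. Poly_Mapping.keys f \<subseteq> bcarrier X \<times> bcarrier Y}"

definition free_scale :: "complex \<Rightarrow> ('x \<times> 'y \<Rightarrow>\<^sub>0 complex) \<Rightarrow> ('x \<times> 'y \<Rightarrow>\<^sub>0 complex)" where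
  "free_scale c f = Poly_Mapping.map ((*) c) f"

definition free_left ::
  "('a, 'x) bimodule \<Rightarrow> 'a \<Rightarrow> ('x \<times> 'y \<Rightarrow>\<^sub>0 complex) \<Rightarrow> ('x \<times> 'y \<Rightarrow>\<^sub>0 complex)" where
  "free_left X a f = (\<Sum>(x, y)\<in>Poly_Mapping.keys f.
     Poly_Mapping.single (bleft X a x, y) (Poly_Mapping.lookup f (x, y)))"

definition free_right ::
  "('a, 'y) bimodule \<Rightarrow> ('x \<times> 'y \<Rightarrow>\<^sub>0 complex) \<Rightarrow> 'a \<Rightarrow> ('x \<times> 'y \<Rightarrow>\<^sub>0 complex)" where
  "free_right Y f a = (\<Sum>(x, y)\<in>Poly_Mapping.keys f.
     Poly_Mapping.single (x, bright Y y a) (Poly_Mapping.lookup f (x, y)))"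

definition free_inner ::
  "('a::ring) star_algebra \<Rightarrow> ('a, 'x) bimodule \<Rightarrow> ('a, 'y) bimodule
    \<Rightarrow> ('x \<times> 'y \<Rightarrow>\<^sub>0 complex) \<Rightarrow> ('x \<times> 'y \<Rightarrow>\<^sub>0 complex) \<Rightarrow> 'a" where
  "free_inner A X Y f g = (\<Sum>(x, y)\<in>Poly_Mapping.keys f. \<Sum>(x', y')\<in>Poly_Mapping.keys g.
     ascale A (cnj (Poly_Mapping.lookup f (x, y)) * Poly_Mapping.lookup g (x', y'))
       (binner Y y (bleft Y (binner X x x') y')))"

definition free_dist ::
  "('a::ring) star_algebra \<Rightarrow> ('a, 'x) bimodule \<Rightarrow> ('a, 'y) bimodule
    \<Rightarrow> ('x \<times> 'y \<Rightarrow>\<^sub>0 complex) \<Rightarrow> ('x \<times> 'y \<Rightarrow>\<^sub>0 complex) \<Rightarrow> real" where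
  "free_dist A X Y f g = sqrt (anorm A (free_inner A X Y (f - g) (f - g)))"

definition tensor_cauchy ::
  "('a::ring) star_algebra \<Rightarrow> ('a, 'x) bimodule \<Rightarrow> ('a, 'y) bimodule
    \<Rightarrow> (nat \<Rightarrow> ('x \<times> 'y \<Rightarrow>\<^sub>0 complex)) set" where
  "tensor_cauchy A X Y = {\<sigma>. range \<sigma> \<subseteq> free_carrier X Y \<and> cauchy_wrt (free_dist A X Y) \<sigma>}"

definition tensor_rel ::
  "('a::ring) star_algebra \<Rightarrow> ('a, 'x) bimodule \<Rightarrow> ('a, 'y) bimodule
    \<Rightarrow> ((nat \<Rightarrow> ('x \<times> 'y \<Rightarrow>\<^sub>0 complex)) \<times> (nat \<Rightarrow> ('x \<times> 'y \<Rightarrow>\<^sub>0 complex))) set" where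
  "tensor_rel A X Y = {(\<sigma>, \<tau>). \<sigma> \<in> tensor_cauchy A X Y \<and> \<tau> \<in> tensor_cauchy A X Y \<and>
     (\<lambda>n. free_dist A X Y (\<sigma> n) (\<tau> n)) \<longlonglongrightarrow> 0}"

definition tensor ::
  "('a::ring) star_algebra \<Rightarrow> ('a, 'x) bimodule \<Rightarrow> ('a, 'y) bimodule
    \<Rightarrow> ('a, (nat \<Rightarrow> ('x \<times> 'y \<Rightarrow>\<^sub>0 complex)) set) bimodule" where
  "tensor A X Y = (let R = tensor_rel A X Y in
    \<lparr>bcarrier = tensor_cauchy A X Y // R,
     badd = (\<lambda>S T. \<Union>\<sigma>\<in>S. \<Union>\<tau>\<in>T. R `` {\<lambda>n. \<sigma> n + \<tau> n}),
     bzero = R `` {\<lambda>n. 0},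
     bscale = (\<lambda>c S. \<Union>\<sigma>\<in>S. R `` {\<lambda>n. free_scale c (\<sigma> n)}),
     bright = (\<lambda>S a. \<Union>\<sigma>\<in>S. R `` {\<lambda>n. free_right Y (\<sigma> n) a}),
     bleft = (\<lambda>a S. \<Union>\<sigma>\<in>S. R `` {\<lambda>n. free_left X a (\<sigma> n)}),
     binner = (\<lambda>S T. THE c. c \<in> alg A \<and>
       (\<forall>\<sigma>\<in>S. \<forall>\<tau>\<in>T. (\<lambda>n. anorm A (free_inner A X Y (\<sigma> n) (\<tau> n) - c)) \<longlonglongrightarrow> 0))\<rparr>)"

definition elem_tensor ::
  "('a::ring) star_algebra \<Rightarrow> ('a, 'x) bimodule \<Rightarrow> ('a, 'y) bimodule \<Rightarrow> 'x \<Rightarrow> 'y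
    \<Rightarrow> (nat \<Rightarrow> ('x \<times> 'y \<Rightarrow>\<^sub>0 complex)) set" where
  "elem_tensor A X Y x y = tensor_rel A X Y `` {\<lambda>n. Poly_Mapping.single (x, y) 1}"


section \<open>Product systems of Hilbert bimodules\<close>

text \<open>
  The disjoint union of the fibres consists of the pairs \<open>(p, x)\<close> with \<open>x \<in> X p\<close>, so that
  the zero elements of different fibres are kept apart.
\<close>

definition total_space :: "('p \<Rightarrow> ('a, 'x) bimodule) \<Rightarrow> ('p \<times> 'x) set" where
  "total_space X = (SIGMA p:UNIV. bcarrier (X p))"

locale bimodule_product_system =
  fixes A :: "('a::ring) star_algebra"
    and X :: "'p::monoid_mult \<Rightarrow> ('a, 'a) bimodule"
    and m :: "'p \<times> 'a \<Rightarrow> 'p \<times> 'a \<Rightarrow> 'p \<times> 'a"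
  assumes fibre: "hilbert_bimodule A (X p)"
    and fibre_one: "bimodule_iso A (self_bimodule A) (X 1) (\<lambda>a. a)"
    and mult_fibre: "\<lbrakk>x \<in> bcarrier (X p); y \<in> bcarrier (X q)\<rbrakk>
      \<Longrightarrow> m (p, x) (q, y) \<in> {p * q} \<times> bcarrier (X (p * q))"
    and mult_assoc: "\<lbrakk>\<xi> \<in> total_space X; \<eta> \<in> total_space X; \<zeta> \<in> total_space X\<rbrakk>
      \<Longrightarrow> m (m \<xi> \<eta>) \<zeta> = m \<xi> (m \<eta> \<zeta>)"
    and mult_tensor: "\<lbrakk>p \<noteq> 1; q \<noteq> 1\<rbrakk>
      \<Longrightarrow> \<exists>U. bimodule_iso A (tensor A (X p) (X q)) (X (p * q)) U \<and>
            (\<forall>x\<in>bcarrier (X p). \<forall>y\<in>bcarrier (X q).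
               m (p, x) (q, y) = (p * q, U (elem_tensor A (X p) (X q) x y)))"
    and mult_one_left: "\<lbrakk>a \<in> alg A; x \<in> bcarrier (X p)\<rbrakk> \<Longrightarrow> m (1, a) (p, x) = (p, bleft (X p) a x)"
    and mult_one_right: "\<lbrakk>a \<in> alg A; x \<in> bcarrier (X p)\<rbrakk> \<Longrightarrow> m (p, x) (1, a) = (p, bright (X p) x a)"


section \<open>Graphs and their Cuntz-Krieger bimodules\<close>

text \<open>
  The source and range maps of a graph are \<^const>\<open>tail\<close> and \<^const>\<open>head\<close>.
\<close>

definition fibre_product :: "('v, 'e) pre_digraph \<Rightarrow> ('v, 'f) pre_digraph \<Rightarrow> ('v, 'e \<times> 'f) pre_digraph"
  where
  "fibre_product E F = \<lparr>verts = verts E,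
     arcs = {(l, k). l \<in> arcs E \<and> k \<in> arcs F \<and> head E l = tail F k},
     tail = (\<lambda>(l, k). tail E l), head = (\<lambda>(l, k). head F k)\<rparr>"

definition graph_iso_over_verts ::
  "('v, 'e) pre_digraph \<Rightarrow> ('v, 'f) pre_digraph \<Rightarrow> ('e \<Rightarrow> 'f) \<Rightarrow> bool" where
  "graph_iso_over_verts E F f \<longleftrightarrow> verts E = verts F \<and> bij_betw f (arcs E) (arcs F) \<and>
     (\<forall>l\<in>arcs E. tail F (f l) = tail E l \<and> head F (f l) = head E l)"

text \<open>
  Vertices and edges have the same type because the edges of \<open>E\<^sub>e\<close> are the vertices.
\<close>

locale graph_product_system =
  fixes V :: "'v set"
    and E :: "'p::monoid_mult \<Rightarrow> ('v, 'v) pre_digraph"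
    and \<phi> :: "'p \<Rightarrow> 'p \<Rightarrow> 'v \<times> 'v \<Rightarrow> 'v"
  assumes countable_verts: "countable V"
    and countable_arcs: "countable (arcs (E p))"
    and graph: "wf_digraph (E p)"
    and verts: "verts (E p) = V"
    and arcs_disjoint: "p \<noteq> q \<Longrightarrow> arcs (E p) \<inter> arcs (E q) = {}"
    and iso: "graph_iso_over_verts (fibre_product (E p) (E q)) (E (p * q)) (\<phi> p q)"
    and assoc: "\<lbrakk>(l, k) \<in> arcs (fibre_product (E p) (E q)); (k, n) \<in> arcs (fibre_product (E q) (E r))\<rbrakk>
      \<Longrightarrow> \<phi> (p * q) r (\<phi> p q (l, k), n) = \<phi> p (q * r) (l, \<phi> q r (k, n))"
    and arcs_one: "arcs (E 1) = V"
    and tail_one: "v \<in> V \<Longrightarrow> tail (E 1) v = v"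
    and head_one: "v \<in> V \<Longrightarrow> head (E 1) v = v"

definition all_arcs :: "('p \<Rightarrow> ('v, 'e) pre_digraph) \<Rightarrow> 'e set" where
  "all_arcs E = (\<Union>p. arcs (E p))"

definition degree :: "('p \<Rightarrow> ('v, 'e) pre_digraph) \<Rightarrow> 'e \<Rightarrow> 'p" where
  "degree E l = (THE p. l \<in> arcs (E p))"

text \<open>
  A function on a set is represented by its extension by zero to the whole type. Vertex sets are
  discrete, so vanishing at infinity means being at least \<open>\<epsilon>\<close> at finitely many vertices only.
\<close>

definition vanishes_at_infinity :: "'v set \<Rightarrow> ('v \<Rightarrow> 'b::real_normed_vector) \<Rightarrow> bool" where
  "vanishes_at_infinity V f \<longleftrightarrow> (\<forall>\<epsilon>>0. finite {v \<in> V. norm (f v) \<ge> \<epsilon>})"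

definition C0 :: "'v set \<Rightarrow> ('v \<Rightarrow> complex) star_algebra" where
  "C0 V = \<lparr>alg = {f. (\<forall>v. v \<notin> V \<longrightarrow> f v = 0) \<and> vanishes_at_infinity V f},
     ascale = (\<lambda>c f v. c * f v), astar = (\<lambda>f v. cnj (f v)), anorm = (\<lambda>f. SUP v. cmod (f v))\<rparr>"

definition ck_bimodule :: "('v, 'e) pre_digraph \<Rightarrow> ('v \<Rightarrow> complex, 'e \<Rightarrow> complex) bimodule" where
  "ck_bimodule E =
    \<lparr>bcarrier = {x. (\<forall>l. l \<notin> arcs E \<longrightarrow> x l = 0) \<and>
       (\<forall>v\<in>verts E. (\<lambda>l. (cmod (x l))\<^sup>2) summable_on {l \<in> arcs E. head E l = v}) \<and>
       vanishes_at_infinity (verts E) (\<lambda>v. \<Sum>\<^sub>\<infinity>l\<in>{l \<in> arcs E. head E l = v}. (cmod (x l))\<^sup>2)},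
     badd = (+), bzero = 0, bscale = (\<lambda>c x l. c * x l),
     bright = (\<lambda>x a l. x l * a (head E l)),
     bleft = (\<lambda>a x l. a (tail E l) * x l),
     binner = (\<lambda>x y v. \<Sum>\<^sub>\<infinity>l\<in>{l \<in> arcs E. head E l = v}. cnj (x l) * y l)\<rparr>"

definition point_mass :: "'e \<Rightarrow> 'e \<Rightarrow> complex" where
  "point_mass l = (\<lambda>k. if k = l then 1 else 0)"

text \<open>The rule \<open>\<delta>\<^sub>\<lambda>\<delta>\<^sub>\<mu> = \<delta>\<^sub>\<lambda>\<^sub>\<mu>\<close> or \<open>0\<close>, the latter being the zero of the fibre over \<open>d(\<lambda>)d(\<mu>)\<close>.\<close>

definition point_mass_rule ::
  "('p::monoid_mult \<Rightarrow> ('v, 'v) pre_digraph) \<Rightarrow> ('p \<Rightarrow> 'p \<Rightarrow> 'v \<times> 'v \<Rightarrow> 'v)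
    \<Rightarrow> ('p \<times> ('v \<Rightarrow> complex) \<Rightarrow> 'p \<times> ('v \<Rightarrow> complex) \<Rightarrow> 'p \<times> ('v \<Rightarrow> complex)) \<Rightarrow> bool" where
  "point_mass_rule E \<phi> m \<longleftrightarrow> (\<forall>l\<in>all_arcs E. \<forall>k\<in>all_arcs E.
     m (degree E l, point_mass l) (degree E k, point_mass k) =
       (degree E l * degree E k,
        if (l, k) \<in> arcs (fibre_product (E (degree E l)) (E (degree E k)))
        then point_mass (\<phi> (degree E l) (degree E k) (l, k)) else 0))"

end

(* Every edge n of E_{pq} factorises uniquely as n = lk with l in E_p and k in E_q, and the product
   of x and y is the function with (xy)(lk) = x(l) y(k). Summing over n with given range v, first
   over l and then over k, gives <xy, x'y'> = <y, <x, x'> y'>, the inner product of elementary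
   tensors. Hence xy depends isometrically on x (x) y, and since finite combinations of point
   masses are dense, X(E_p) (x) X(E_q) is mapped onto X(E_{pq}). Conversely, in any product system
   obeying the point mass rule the coefficient of xy at lk is <delta_l delta_k, xy>, which the
   isomorphism with the tensor product determines. *)
theory Submission
  imports Defs
begin

section \<open>Hilbert bimodules with a norm\<close>

text \<open>The tensor product is a quotient of Cauchy sequences in a free vector space. Its
  operations are unions over representatives and its inner product is a definite description, so a
  direct treatment would have to prove well-definedness operation by operation. Instead, each
  equivalence class is recognised as the set of all sequences whose images in X(E_pq) converge to
  one element z. Such a class is known completely, and every operation on it is read off from the
  operation on z. The completeness that this uses is that of X(E_pq).

  The product is defined coefficient by coefficient rather than extended from point masses. It
  therefore makes sense for arbitrary functions, and associativity becomes an identity between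
  products of three numbers.

  For uniqueness, neither bilinearity nor continuity of the given multiplication is an axiom. Both
  are contained in the isomorphism with the tensor product, which is available only when both
  degrees differ from the identity. If one degree is the identity, its fibre is the coefficient
  algebra and a module action prescribes the product.\<close>

context cstar_algebra
begin

text \<open>Submultiplicativity turns the C*-identity into ||b||^2 <= ||b*|| ||b||. Cancelling
  ||b||, and using the result for a and for a*, gives both inequalities.\<close>

lemma norm_star: "a \<in> alg A \<Longrightarrow> anorm A (astar A a) = anorm A a"
proof -
  have le: "anorm A b \<le> anorm A (astar A b)" if b: "b \<in> alg A" for b
  proof (cases "anorm A b = 0")
    case True
    then show ?thesis using norm_nonneg[OF star_closed[OF b]] by simp
  next
    case False
    then have pos: "anorm A b > 0" using norm_nonneg[OF b] by simp
    have "anorm A b * anorm A b \<le> anorm A (astar A b) * anorm A b"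
      using cstar_identity[OF b] norm_mult[OF star_closed[OF b] b] by (simp add: power2_eq_square)
    then show ?thesis using pos by simp
  qed
  assume a: "a \<in> alg A"
  show ?thesis using le[OF a] le[OF star_closed[OF a]] star_star[OF a] by simp
qed

lemma scale_zero_left: "a \<in> alg A \<Longrightarrow> ascale A 0 a = 0"
  using scale_add_left[of a 0 0] by simp

lemma scale_minus_one: "a \<in> alg A \<Longrightarrow> ascale A (-1) a = - a"
  using scale_add_left[of a 1 "-1"] scale_zero_left scale_one
  by (metis add.right_inverse neg_eq_iff_add_eq_0)

text \<open>The axioms of the carrier do not mention negation; it is the action of the scalar
  -1.\<close>

lemma minus_closed: "a \<in> alg A \<Longrightarrow> - a \<in> alg A"
  by (metis scale_closed scale_minus_one)

lemma diff_closed: "\<lbrakk>a \<in> alg A; b \<in> alg A\<rbrakk> \<Longrightarrow> a - b \<in> alg A"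
  using add_closed[of a "-b"] minus_closed[of b] by simp

lemma norm_minus: "a \<in> alg A \<Longrightarrow> anorm A (- a) = anorm A a"
  using norm_scale[of a "-1"] scale_minus_one by simp

end

definition bnorm :: "('a::ring) star_algebra \<Rightarrow> ('a, 'x) bimodule \<Rightarrow> 'x \<Rightarrow> real" where
  "bnorm A X x = sqrt (anorm A (binner X x x))"

text \<open>
  The Cauchy-Schwarz inequality and the norm bound of the left action hold in every Hilbert
  bimodule. They are assumed because their general proofs need the functional calculus, while
  for Cuntz-Krieger bimodules both are checked pointwise.
\<close>

locale normed_bimodule = hilbert_bimodule A Z
  for A :: "('a::ring) star_algebra" and Z :: "('a, 'z::ab_group_add) bimodule" +
  assumes badd_plus: "badd Z = (+)"
    and cauchy_schwarz: "\<lbrakk>x \<in> bcarrier Z; y \<in> bcarrier Z\<rbrakk>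
      \<Longrightarrow> anorm A (binner Z x y) \<le> bnorm A Z x * bnorm A Z y"
    and bleft_bound: "\<lbrakk>a \<in> alg A; x \<in> bcarrier Z\<rbrakk>
      \<Longrightarrow> bnorm A Z (bleft Z a x) \<le> anorm A a * bnorm A Z x"
begin

section \<open>Module arithmetic and sesquilinearity\<close>

lemma bzero_eq: "bzero Z = 0"
  using badd_zero[OF bzero_closed] by (simp add: badd_plus)

lemma plus_closed: "\<lbrakk>x \<in> bcarrier Z; y \<in> bcarrier Z\<rbrakk> \<Longrightarrow> x + y \<in> bcarrier Z"
  using badd_closed by (simp add: badd_plus)

lemma bzero_mem: "0 \<in> bcarrier Z"
  using bzero_closed by (simp add: bzero_eq)

lemma bscale_minus_one: "x \<in> bcarrier Z \<Longrightarrow> bscale Z (-1) x = - x"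
  using badd_minus[of x] by (simp add: badd_plus bzero_eq add_eq_0_iff)

lemma uminus_mem: "x \<in> bcarrier Z \<Longrightarrow> - x \<in> bcarrier Z"
  by (metis bscale_closed bscale_minus_one)

lemma minus_mem: "\<lbrakk>x \<in> bcarrier Z; y \<in> bcarrier Z\<rbrakk> \<Longrightarrow> x - y \<in> bcarrier Z"
  using plus_closed[of x "-y"] uminus_mem by simp

lemma sum_mem: "(\<And>i. i \<in> I \<Longrightarrow> f i \<in> bcarrier Z) \<Longrightarrow> sum f I \<in> bcarrier Z"
  by (induction I rule: infinite_finite_induct) (auto simp: bzero_mem plus_closed)

lemma bdist_bnorm: "\<lbrakk>x \<in> bcarrier Z; y \<in> bcarrier Z\<rbrakk> \<Longrightarrow> bdist A Z x y = bnorm A Z (x - y)"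
  by (simp add: bdist_def bnorm_def bscale_minus_one badd_plus Let_def)

lemma bscale_zero: "x \<in> bcarrier Z \<Longrightarrow> bscale Z 0 x = 0"
  using bscale_add_left[of x 0 0] by (simp add: badd_plus)

lemma bscale_plus: "\<lbrakk>x \<in> bcarrier Z; y \<in> bcarrier Z\<rbrakk> \<Longrightarrow> bscale Z c (x + y) = bscale Z c x + bscale Z c y"
  using bscale_add_right by (simp add: badd_plus)

lemma bscale_zero_right: "bscale Z c 0 = 0"
  using bscale_plus[OF bzero_mem bzero_mem] by simp

lemma bscale_sum: "(\<And>i. i \<in> I \<Longrightarrow> f i \<in> bcarrier Z) \<Longrightarrow> bscale Z c (sum f I) = (\<Sum>i\<in>I. bscale Z c (f i))"
  by (induction I rule: infinite_finite_induct) (auto simp: bscale_zero_right bscale_plus sum_mem)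

lemma binner_plus_right: "\<lbrakk>x \<in> bcarrier Z; y \<in> bcarrier Z; z \<in> bcarrier Z\<rbrakk>
  \<Longrightarrow> binner Z x (y + z) = binner Z x y + binner Z x z"
  using binner_add by (simp add: badd_plus)

lemma binner_plus_left: "\<lbrakk>x \<in> bcarrier Z; y \<in> bcarrier Z; z \<in> bcarrier Z\<rbrakk>
  \<Longrightarrow> binner Z (x + y) z = binner Z x z + binner Z y z"
  by (metis binner_plus_right binner_star binner_closed plus_closed star_add)

lemma binner_scale_left: "\<lbrakk>x \<in> bcarrier Z; y \<in> bcarrier Z\<rbrakk>
  \<Longrightarrow> binner Z (bscale Z c x) y = ascale A (cnj c) (binner Z x y)"
  by (metis binner_scale binner_star binner_closed bscale_closed star_scale)

lemma binner_zero_right: "x \<in> bcarrier Z \<Longrightarrow> binner Z x 0 = 0"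
  using binner_plus_right[OF _ bzero_mem bzero_mem] by simp

lemma binner_zero_left: "x \<in> bcarrier Z \<Longrightarrow> binner Z 0 x = 0"
  using binner_plus_left[OF bzero_mem bzero_mem] by simp

lemma binner_minus_right: "\<lbrakk>x \<in> bcarrier Z; y \<in> bcarrier Z\<rbrakk> \<Longrightarrow> binner Z x (- y) = - binner Z x y"
  using binner_plus_right[of x y "- y"]
  by (simp add: uminus_mem binner_zero_right) (metis add.inverse_unique)

lemma binner_diff_right: "\<lbrakk>x \<in> bcarrier Z; y \<in> bcarrier Z; z \<in> bcarrier Z\<rbrakk>
  \<Longrightarrow> binner Z x (y - z) = binner Z x y - binner Z x z"
  using binner_plus_right[of x y "- z"] by (simp add: uminus_mem binner_minus_right)

lemma binner_diff_left: "\<lbrakk>x \<in> bcarrier Z; y \<in> bcarrier Z; z \<in> bcarrier Z\<rbrakk>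
  \<Longrightarrow> binner Z (x - y) z = binner Z x z - binner Z y z"
  using binner_plus_left[of "x - y" y z] by (simp add: minus_mem)

lemma binner_sum_right: "x \<in> bcarrier Z \<Longrightarrow> (\<And>i. i \<in> I \<Longrightarrow> f i \<in> bcarrier Z)
  \<Longrightarrow> binner Z x (sum f I) = (\<Sum>i\<in>I. binner Z x (f i))"
  by (induction I rule: infinite_finite_induct) (auto simp: binner_zero_right binner_plus_right sum_mem)

lemma binner_sum_left: "x \<in> bcarrier Z \<Longrightarrow> (\<And>i. i \<in> I \<Longrightarrow> f i \<in> bcarrier Z)
  \<Longrightarrow> binner Z (sum f I) x = (\<Sum>i\<in>I. binner Z (f i) x)"
  by (induction I rule: infinite_finite_induct) (auto simp: binner_zero_left binner_plus_left sum_mem)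

text \<open>Definiteness, applied to x - y. Identities between adjointable operators are proved with
  it, by testing against every z.\<close>

lemma binner_eqI:
  assumes "x \<in> bcarrier Z" "y \<in> bcarrier Z" "\<And>z. z \<in> bcarrier Z \<Longrightarrow> binner Z z x = binner Z z y"
  shows "x = y"
proof -
  have "binner Z (x - y) (x - y) = 0"
    using assms by (simp add: binner_diff_right minus_mem)
  then show ?thesis using binner_definite[OF minus_mem[OF assms(1,2)]] by (simp add: bzero_eq)
qed

lemma binner_bleft: "\<lbrakk>a \<in> alg A; x \<in> bcarrier Z; y \<in> bcarrier Z\<rbrakk>
  \<Longrightarrow> binner Z x (bleft Z a y) = binner Z (bleft Z (astar A a) x) y"
  using bleft_adjoint[of "astar A a" x y] by (simp add: star_closed star_star)

text \<open>Additivity in the module variable is not an axiom, but an operator with an adjoint has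
  it: moved to the other side of the inner product, the operator meets only the additivity of that
  product.\<close>

lemma bleft_plus: "\<lbrakk>a \<in> alg A; x \<in> bcarrier Z; y \<in> bcarrier Z\<rbrakk>
  \<Longrightarrow> bleft Z a (x + y) = bleft Z a x + bleft Z a y"
  by (rule binner_eqI) (auto simp: bleft_closed plus_closed binner_bleft binner_plus_right star_closed)

lemma bleft_bscale: "\<lbrakk>a \<in> alg A; x \<in> bcarrier Z\<rbrakk> \<Longrightarrow> bleft Z a (bscale Z c x) = bscale Z c (bleft Z a x)"
  by (rule binner_eqI) (auto simp: bleft_closed bscale_closed binner_bleft binner_scale star_closed)

lemma bleft_zero: "a \<in> alg A \<Longrightarrow> bleft Z a 0 = 0"
  using bleft_plus[OF _ bzero_mem bzero_mem] by simp

lemma bleft_diff: "\<lbrakk>a \<in> alg A; x \<in> bcarrier Z; y \<in> bcarrier Z\<rbrakk>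
  \<Longrightarrow> bleft Z a (x - y) = bleft Z a x - bleft Z a y"
  using bleft_plus[of a "x - y" y] by (simp add: minus_mem)

lemma bleft_sum: "a \<in> alg A \<Longrightarrow> (\<And>i. i \<in> I \<Longrightarrow> f i \<in> bcarrier Z)
  \<Longrightarrow> bleft Z a (sum f I) = (\<Sum>i\<in>I. bleft Z a (f i))"
  by (induction I rule: infinite_finite_induct) (auto simp: bleft_zero bleft_plus sum_mem)

lemma bright_plus: "\<lbrakk>a \<in> alg A; x \<in> bcarrier Z; y \<in> bcarrier Z\<rbrakk>
  \<Longrightarrow> bright Z (x + y) a = bright Z x a + bright Z y a"
  using bright_add_left by (simp add: badd_plus)

lemma bright_zero: "a \<in> alg A \<Longrightarrow> bright Z 0 a = 0"
  using bright_plus[OF _ bzero_mem bzero_mem] by simp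

lemma bright_diff: "\<lbrakk>a \<in> alg A; x \<in> bcarrier Z; y \<in> bcarrier Z\<rbrakk>
  \<Longrightarrow> bright Z (x - y) a = bright Z x a - bright Z y a"
  using bright_plus[of a "x - y" y] by (simp add: minus_mem)

lemma bright_sum: "a \<in> alg A \<Longrightarrow> (\<And>i. i \<in> I \<Longrightarrow> f i \<in> bcarrier Z)
  \<Longrightarrow> bright Z (sum f I) a = (\<Sum>i\<in>I. bright Z (f i) a)"
  by (induction I rule: infinite_finite_induct) (auto simp: bright_zero bright_plus sum_mem)

section \<open>The norm and the boundedness of the actions\<close>

lemma bnorm_nonneg: "x \<in> bcarrier Z \<Longrightarrow> 0 \<le> bnorm A Z x"
  by (simp add: bnorm_def norm_nonneg binner_closed)

lemma bnorm_power2: "x \<in> bcarrier Z \<Longrightarrow> (bnorm A Z x)\<^sup>2 = anorm A (binner Z x x)"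
  by (simp add: bnorm_def norm_nonneg binner_closed)

lemma bnorm_zero: "bnorm A Z 0 = 0"
  using norm_eq_zero[OF zero_closed] by (simp add: bnorm_def binner_zero_right bzero_mem)

lemma bnorm_eq_zeroD: "\<lbrakk>x \<in> bcarrier Z; bnorm A Z x = 0\<rbrakk> \<Longrightarrow> x = 0"
  using binner_definite[of x] norm_eq_zero[of "binner Z x x"] binner_closed[of x x]
  by (simp add: bnorm_def bzero_eq)

lemma bnorm_scale: "x \<in> bcarrier Z \<Longrightarrow> bnorm A Z (bscale Z c x) = cmod c * bnorm A Z x"
  by (simp add: bnorm_def binner_scale binner_scale_left bscale_closed binner_closed norm_scale
      scale_closed real_sqrt_mult flip: mult.assoc)

lemma bnorm_minus: "x \<in> bcarrier Z \<Longrightarrow> bnorm A Z (- x) = bnorm A Z x"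
  using bnorm_scale[of x "-1"] by (simp add: bscale_minus_one)

lemma bnorm_triangle:
  assumes "x \<in> bcarrier Z" "y \<in> bcarrier Z"
  shows "bnorm A Z (x + y) \<le> bnorm A Z x + bnorm A Z y"
proof -
  have "(bnorm A Z (x + y))\<^sup>2 =
      anorm A ((binner Z x x + binner Z x y) + (binner Z y x + binner Z y y))"
    using assms by (simp add: bnorm_power2 plus_closed binner_plus_left binner_plus_right algebra_simps)
  also have "\<dots> \<le> (anorm A (binner Z x x) + anorm A (binner Z x y)) +
      (anorm A (binner Z y x) + anorm A (binner Z y y))"
    using assms by (intro norm_triangle[THEN order_trans] add_mono norm_triangle add_closed binner_closed)
  also have "\<dots> \<le> ((bnorm A Z x)\<^sup>2 + bnorm A Z x * bnorm A Z y) +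
      (bnorm A Z y * bnorm A Z x + (bnorm A Z y)\<^sup>2)"
    using assms by (intro add_mono cauchy_schwarz) (auto simp: bnorm_power2)
  also have "\<dots> = (bnorm A Z x + bnorm A Z y)\<^sup>2"
    by (simp add: power2_eq_square algebra_simps)
  finally show ?thesis
    using assms by (auto intro: power2_le_imp_le simp: bnorm_nonneg)
qed

text \<open>In contrast to \<open>bleft_bound\<close>, which is assumed, this follows from the
  axioms: <xa, xa> = a* <x, x> a, and a* has the norm of a.\<close>

lemma bright_bound:
  assumes "a \<in> alg A" "x \<in> bcarrier Z"
  shows "bnorm A Z (bright Z x a) \<le> anorm A a * bnorm A Z x"
proof -
  have xa: "bright Z x a \<in> bcarrier Z" using assms by (simp add: bright_closed)
  have "binner Z (bright Z x a) x = astar A a * binner Z x x"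
    using assms xa by (metis binner_closed binner_right binner_star star_mult)
  then have "(bnorm A Z (bright Z x a))\<^sup>2 = anorm A ((astar A a * binner Z x x) * a)"
    using assms xa by (simp add: bnorm_power2 binner_right)
  also have "\<dots> \<le> (anorm A (astar A a) * anorm A (binner Z x x)) * anorm A a"
    using assms by (intro norm_mult[THEN order_trans] mult_right_mono norm_mult)
      (auto simp: star_closed binner_closed mult_closed norm_nonneg)
  also have "\<dots> = (anorm A a * bnorm A Z x)\<^sup>2"
    using assms by (simp add: norm_star power_mult_distrib bnorm_power2) (simp add: power2_eq_square)
  finally show ?thesis
    using assms by (auto intro: power2_le_imp_le simp: bnorm_nonneg norm_nonneg)
qed

section \<open>Convergence in norm\<close>

definition converges :: "(nat \<Rightarrow> 'z) \<Rightarrow> 'z \<Rightarrow> bool" where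
  "converges s z \<longleftrightarrow> (\<lambda>n. bnorm A Z (s n - z)) \<longlonglongrightarrow> 0"

lemma convergesI:
  assumes "\<And>n. s n \<in> bcarrier Z" "z \<in> bcarrier Z" "\<And>n. bnorm A Z (s n - z) \<le> b n" "b \<longlonglongrightarrow> 0"
  shows "converges s z"
  unfolding converges_def
  by (rule tendsto_sandwich[OF _ _ tendsto_const assms(4)])
    (auto simp: assms bnorm_nonneg minus_mem intro!: always_eventually)

lemma converges_const: "converges (\<lambda>_. z) z"
  by (simp add: converges_def bnorm_zero)

lemma converges_add:
  assumes "\<And>n. s n \<in> bcarrier Z" "\<And>n. t n \<in> bcarrier Z" "z \<in> bcarrier Z" "w \<in> bcarrier Z"
    and "converges s z" "converges t w"
  shows "converges (\<lambda>n. s n + t n) (z + w)"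
proof (rule convergesI)
  show "(\<lambda>n. bnorm A Z (s n - z) + bnorm A Z (t n - w)) \<longlonglongrightarrow> 0"
    using tendsto_add[of _ 0 _ _ 0] assms by (fastforce simp: converges_def)
  show "bnorm A Z (s n + t n - (z + w)) \<le> bnorm A Z (s n - z) + bnorm A Z (t n - w)" for n
    using bnorm_triangle[of "s n - z" "t n - w"] assms by (simp add: minus_mem algebra_simps)
qed (use assms in \<open>auto simp: plus_closed\<close>)

lemma converges_bscale:
  assumes "\<And>n. s n \<in> bcarrier Z" "z \<in> bcarrier Z" "converges s z"
  shows "converges (\<lambda>n. bscale Z c (s n)) (bscale Z c z)"
proof (rule convergesI)
  show "(\<lambda>n. cmod c * bnorm A Z (s n - z)) \<longlonglongrightarrow> 0"
    using tendsto_mult_right_zero assms by (auto simp: converges_def)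
  have "bscale Z c (s n - z) = bscale Z c (s n) - bscale Z c z" for n
    using bscale_plus[of "s n - z" z c] assms by (simp add: minus_mem)
  then show "bnorm A Z (bscale Z c (s n) - bscale Z c z) \<le> cmod c * bnorm A Z (s n - z)" for n
    using bnorm_scale[of "s n - z" c] assms by (simp add: minus_mem)
qed (use assms in \<open>auto simp: bscale_closed\<close>)

lemma converges_bleft:
  assumes "\<And>n. s n \<in> bcarrier Z" "z \<in> bcarrier Z" "converges s z" "a \<in> alg A"
  shows "converges (\<lambda>n. bleft Z a (s n)) (bleft Z a z)"
proof (rule convergesI)
  show "(\<lambda>n. anorm A a * bnorm A Z (s n - z)) \<longlonglongrightarrow> 0"
    using tendsto_mult_right_zero assms by (auto simp: converges_def)
  show "bnorm A Z (bleft Z a (s n) - bleft Z a z) \<le> anorm A a * bnorm A Z (s n - z)" for n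
    using bleft_bound[of a "s n - z"] assms by (simp add: minus_mem bleft_diff)
qed (use assms in \<open>auto simp: bleft_closed\<close>)

lemma converges_bright:
  assumes "\<And>n. s n \<in> bcarrier Z" "z \<in> bcarrier Z" "converges s z" "a \<in> alg A"
  shows "converges (\<lambda>n. bright Z (s n) a) (bright Z z a)"
proof (rule convergesI)
  show "(\<lambda>n. anorm A a * bnorm A Z (s n - z)) \<longlonglongrightarrow> 0"
    using tendsto_mult_right_zero assms by (auto simp: converges_def)
  show "bnorm A Z (bright Z (s n) a - bright Z z a) \<le> anorm A a * bnorm A Z (s n - z)" for n
    using bright_bound[of a "s n - z"] assms by (simp add: minus_mem bright_diff)
qed (use assms in \<open>auto simp: bright_closed\<close>)

lemma bnorm_diff_triangle:
  assumes "x \<in> bcarrier Z" "y \<in> bcarrier Z" "z \<in> bcarrier Z"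
  shows "bnorm A Z (x - y) \<le> bnorm A Z (x - z) + bnorm A Z (y - z)"
  using bnorm_triangle[of "x - z" "- (y - z)"] bnorm_minus[of "y - z"] assms
  by (simp add: minus_mem uminus_mem del: minus_diff_eq)

lemma bnorm_diff_commute:
  assumes "x \<in> bcarrier Z" "y \<in> bcarrier Z"
  shows "bnorm A Z (x - y) = bnorm A Z (y - x)"
  using bnorm_minus[of "x - y"] assms by (simp add: minus_mem)

text \<open>Two triangle inequalities. The lemma is the bridge to \<open>tensor_rel\<close>, which
  identifies sequences whose distance tends to 0: after mapping to Z, being identified means having
  the same limit.\<close>

lemma converges_diff_null:
  assumes "\<And>n. s n \<in> bcarrier Z" "\<And>n. t n \<in> bcarrier Z" "z \<in> bcarrier Z" "converges s z"
  shows "converges t z \<longleftrightarrow> (\<lambda>n. bnorm A Z (s n - t n)) \<longlonglongrightarrow> 0"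
proof
  assume "converges t z"
  then have "(\<lambda>n. bnorm A Z (s n - z) + bnorm A Z (t n - z)) \<longlonglongrightarrow> 0"
    using tendsto_add[of _ 0 _ _ 0] assms by (fastforce simp: converges_def)
  then show "(\<lambda>n. bnorm A Z (s n - t n)) \<longlonglongrightarrow> 0"
    by (rule tendsto_sandwich[OF _ _ tendsto_const, rotated 2])
      (auto simp: assms bnorm_nonneg minus_mem bnorm_diff_triangle intro!: always_eventually)
next
  assume "(\<lambda>n. bnorm A Z (s n - t n)) \<longlonglongrightarrow> 0"
  then have lim: "(\<lambda>n. bnorm A Z (s n - t n) + bnorm A Z (s n - z)) \<longlonglongrightarrow> 0"
    using tendsto_add[of _ 0 _ _ 0] assms by (fastforce simp: converges_def)
  show "converges t z"
  proof (rule convergesI[OF _ _ _ lim])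
    show "bnorm A Z (t n - z) \<le> bnorm A Z (s n - t n) + bnorm A Z (s n - z)" for n
      using bnorm_diff_triangle[of "t n" z "s n"] assms(1-3)
      by (simp add: bnorm_diff_commute)
  qed (use assms in auto)
qed

lemma converges_unique:
  assumes "\<And>n. s n \<in> bcarrier Z" "z \<in> bcarrier Z" "w \<in> bcarrier Z" "converges s z" "converges s w"
  shows "z = w"
proof -
  have "converges (\<lambda>_. w) z"
    using converges_diff_null[of s "\<lambda>_. w" z] assms by (simp add: converges_def)
  then have "bnorm A Z (w - z) = 0" by (simp add: converges_def LIMSEQ_const_iff)
  then show ?thesis using bnorm_eq_zeroD[of "w - z"] assms by (simp add: minus_mem)
qed

lemma converges_cauchy:
  assumes "\<And>n. s n \<in> bcarrier Z" "z \<in> bcarrier Z" "converges s z"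
  shows "cauchy_wrt (\<lambda>x y. bnorm A Z (x - y)) s"
  unfolding cauchy_wrt_def
proof (intro allI impI)
  fix \<epsilon> :: real assume "\<epsilon> > 0"
  then have "\<forall>\<^sub>F n in sequentially. bnorm A Z (s n - z) < \<epsilon>/2"
    using assms(3) unfolding converges_def by (intro order_tendstoD(2)) auto
  then obtain N where N: "\<And>n. n \<ge> N \<Longrightarrow> bnorm A Z (s n - z) < \<epsilon>/2"
    by (auto simp: eventually_sequentially)
  then have "bnorm A Z (s m - s n) < \<epsilon>" if "m \<ge> N" "n \<ge> N" for m n
    using bnorm_diff_triangle[of "s m" "s n" z] assms N[OF that(1)] N[OF that(2)] by simp
  then show "\<exists>N. \<forall>m\<ge>N. \<forall>n\<ge>N. bnorm A Z (s m - s n) < \<epsilon>" by blast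
qed

lemma cauchy_converges:
  assumes "\<And>n. s n \<in> bcarrier Z" "cauchy_wrt (\<lambda>x y. bnorm A Z (x - y)) s"
  obtains z where "z \<in> bcarrier Z" "converges s z"
proof -
  have "cauchy_wrt (bdist A Z) s"
    using assms by (simp add: cauchy_wrt_def bdist_bnorm)
  then obtain z where "z \<in> bcarrier Z" "(\<lambda>n. bdist A Z (s n) z) \<longlonglongrightarrow> 0"
    using bcomplete assms(1) unfolding complete_wrt_def by blast
  then show ?thesis using that assms(1) by (simp add: converges_def bdist_bnorm)
qed

lemma converges_binner:
  assumes "\<And>n. s n \<in> bcarrier Z" "\<And>n. t n \<in> bcarrier Z" "z \<in> bcarrier Z" "w \<in> bcarrier Z"
    and "converges s z" "converges t w"
  shows "(\<lambda>n. anorm A (binner Z (s n) (t n) - binner Z z w)) \<longlonglongrightarrow> 0"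
proof (rule tendsto_sandwich[OF _ _ tendsto_const])
  let ?S = "\<lambda>n. bnorm A Z (s n - z)" and ?T = "\<lambda>n. bnorm A Z (t n - w)"
  show "(\<lambda>n. ?S n * (?T n + bnorm A Z w) + bnorm A Z z * ?T n) \<longlonglongrightarrow> 0"
    using assms(5,6) unfolding converges_def by (auto intro!: tendsto_eq_intros)
  have "anorm A (binner Z (s n) (t n) - binner Z z w) \<le>
      ?S n * (?T n + bnorm A Z w) + bnorm A Z z * ?T n" for n
  proof -
    \<comment> \<open>One argument is changed at a time. The remaining factor ||t n|| is bounded by
      ||t n - w|| + ||w||, which converges.\<close>
    have "binner Z (s n) (t n) - binner Z z w = binner Z (s n - z) (t n) + binner Z z (t n - w)"
      using assms by (simp add: binner_diff_left binner_diff_right)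
    then have "anorm A (binner Z (s n) (t n) - binner Z z w) \<le>
        anorm A (binner Z (s n - z) (t n)) + anorm A (binner Z z (t n - w))"
      using assms by (simp add: norm_triangle binner_closed minus_mem)
    also have "\<dots> \<le> ?S n * bnorm A Z (t n) + bnorm A Z z * ?T n"
      using assms by (intro add_mono cauchy_schwarz) (auto simp: minus_mem)
    also have "\<dots> \<le> ?S n * (?T n + bnorm A Z w) + bnorm A Z z * ?T n"
      using bnorm_triangle[of "t n - w" w] assms
      by (intro add_right_mono mult_left_mono) (auto simp: minus_mem bnorm_nonneg)
    finally show ?thesis .
  qed
  then show "\<forall>\<^sub>F n in sequentially. anorm A (binner Z (s n) (t n) - binner Z z w) \<le>
      ?S n * (?T n + bnorm A Z w) + bnorm A Z z * ?T n" by simp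
  show "\<forall>\<^sub>F n in sequentially. 0 \<le> anorm A (binner Z (s n) (t n) - binner Z z w)"
    using assms by (simp add: norm_nonneg diff_closed binner_closed)
qed

end

section \<open>Realisations of the balanced tensor product\<close>

text \<open>The inner product of \<open>tensor\<close> is a definite description of a limit in the
  norm of A; this supplies its uniqueness.\<close>

lemma (in cstar_algebra) limit_unique:
  assumes "\<And>n::nat. s n \<in> alg A" "c \<in> alg A" "d \<in> alg A"
    and "(\<lambda>n. anorm A (s n - c)) \<longlonglongrightarrow> 0" "(\<lambda>n. anorm A (s n - d)) \<longlonglongrightarrow> 0"
  shows "c = d"
proof -
  have "anorm A (c - d) \<le> anorm A (s n - c) + anorm A (s n - d)" for n
    using norm_triangle[of "- (s n - c)" "s n - d"] norm_minus[of "s n - c"] assms(1-3)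
    by (simp add: diff_closed minus_closed del: minus_diff_eq)
  moreover have "(\<lambda>n. anorm A (s n - c) + anorm A (s n - d)) \<longlonglongrightarrow> 0 + 0"
    using assms(4,5) by (rule tendsto_add)
  ultimately have "anorm A (c - d) \<le> 0"
    by (intro LIMSEQ_le[OF tendsto_const]) auto
  then show ?thesis
    using norm_nonneg[of "c - d"] norm_eq_zero[of "c - d"] assms(2,3) by (simp add: diff_closed)
qed

section \<open>Closure properties of the free vector space on pairs\<close>

lemma free_carrier_add: "f \<in> free_carrier X Y \<Longrightarrow> g \<in> free_carrier X Y \<Longrightarrow> f + g \<in> free_carrier X Y"
  using Poly_Mapping.keys_add[of f g] by (auto simp: free_carrier_def)

lemma free_carrier_diff: "f \<in> free_carrier X Y \<Longrightarrow> g \<in> free_carrier X Y \<Longrightarrow> f - g \<in> free_carrier X Y"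
  using keys_diff[of f g] by (auto simp: free_carrier_def)

lemma free_carrier_zero: "0 \<in> free_carrier X Y"
  by (simp add: free_carrier_def)

lemma free_carrier_single:
  "x \<in> bcarrier X \<Longrightarrow> y \<in> bcarrier Y \<Longrightarrow> Poly_Mapping.single (x, y) c \<in> free_carrier X Y"
  by (simp add: free_carrier_def)

lemma free_carrier_sum: "(\<And>i. i \<in> I \<Longrightarrow> f i \<in> free_carrier X Y) \<Longrightarrow> sum f I \<in> free_carrier X Y"
  by (induction I rule: infinite_finite_induct) (auto simp: free_carrier_zero free_carrier_add)

lemma keys_free_scale: "Poly_Mapping.keys (free_scale c f) \<subseteq> Poly_Mapping.keys f"
  by (auto simp: free_scale_def in_keys_iff map.rep_eq when_def)

lemma lookup_free_scale: "Poly_Mapping.lookup (free_scale c f) p = c * Poly_Mapping.lookup f p"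
  by (simp add: free_scale_def map.rep_eq when_def)

lemma free_carrier_scale: "f \<in> free_carrier X Y \<Longrightarrow> free_scale c f \<in> free_carrier X Y"
  using keys_free_scale[of c f] by (auto simp: free_carrier_def)

text \<open>The comparison is built from Z towards the classes of sequences, whereas a product
  system asks for a map out of the tensor product.\<close>

lemma bimodule_iso_inv:
  assumes "hilbert_bimodule A X" "bimodule_iso A X Y U"
  shows "bimodule_iso A Y X (inv_into (bcarrier X) U)"
proof -
  interpret X: hilbert_bimodule A X by fact
  let ?V = "inv_into (bcarrier X) U"
  have bij: "bij_betw U (bcarrier X) (bcarrier Y)" using assms(2) by (simp add: bimodule_iso_def)
  have VU: "?V (U x) = x" if "x \<in> bcarrier X" for x
    using bij that by (simp add: bij_betw_inv_into_left)
  have img: "bcarrier Y = U ` bcarrier X" using bij by (simp add: bij_betw_def)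
  have "badd Y (U x) (U x') = U (badd X x x')" "bscale Y c (U x) = U (bscale X c x)"
    "binner Y (U x) (U x') = binner X x x'" if "x \<in> bcarrier X" "x' \<in> bcarrier X" for x x' c
    using assms(2) that by (auto simp: bimodule_iso_def)
  moreover have "bright Y (U x) a = U (bright X x a)" "bleft Y a (U x) = U (bleft X a x)"
    if "x \<in> bcarrier X" "a \<in> alg A" for x a
    using assms(2) that by (auto simp: bimodule_iso_def)
  ultimately show ?thesis
    unfolding bimodule_iso_def using bij_betw_inv_into[OF bij]
    by (auto simp: img VU X.badd_closed X.bscale_closed X.bright_closed X.bleft_closed)
qed

text \<open>
  A map on pairs that reproduces the inner products of elementary tensors extends to an isometry
  of the free vector space. Density of its range makes the completion of the latter a copy of
  \<open>Z\<close>.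
\<close>

locale inner_tensor_map = normed_bimodule A Z + X: hilbert_bimodule A X + Y: hilbert_bimodule A Y
  for A :: "('a::ring) star_algebra" and X :: "('a, 'x) bimodule" and Y :: "('a, 'y) bimodule"
    and Z :: "('a, 'z::ab_group_add) bimodule" +
  fixes B :: "'x \<Rightarrow> 'y \<Rightarrow> 'z"
  assumes B_closed: "\<lbrakk>x \<in> bcarrier X; y \<in> bcarrier Y\<rbrakk> \<Longrightarrow> B x y \<in> bcarrier Z"
    and B_inner: "\<lbrakk>x \<in> bcarrier X; y \<in> bcarrier Y; x' \<in> bcarrier X; y' \<in> bcarrier Y\<rbrakk>
      \<Longrightarrow> binner Z (B x y) (B x' y') = binner Y y (bleft Y (binner X x x') y')"
    and B_left: "\<lbrakk>a \<in> alg A; x \<in> bcarrier X; y \<in> bcarrier Y\<rbrakk>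
      \<Longrightarrow> B (bleft X a x) y = bleft Z a (B x y)"
    and B_right: "\<lbrakk>a \<in> alg A; x \<in> bcarrier X; y \<in> bcarrier Y\<rbrakk>
      \<Longrightarrow> B x (bright Y y a) = bright Z (B x y) a"
begin

section \<open>The isometric extension to the free vector space\<close>

definition ext :: "('x \<times> 'y \<Rightarrow>\<^sub>0 complex) \<Rightarrow> 'z" where
  "ext f = (\<Sum>p\<in>Poly_Mapping.keys f. bscale Z (Poly_Mapping.lookup f p) (case_prod B p))"

lemma case_prod_B_closed: "p \<in> bcarrier X \<times> bcarrier Y \<Longrightarrow> case_prod B p \<in> bcarrier Z"
  by (auto simp: B_closed)

text \<open>Cancellation can remove keys from a sum or a multiple, so the sums defining
  \<open>ext\<close> for different arguments have different index sets. A common finite superset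
  makes them comparable.\<close>

lemma ext_superset:
  assumes "finite S" "Poly_Mapping.keys f \<subseteq> S" "S \<subseteq> bcarrier X \<times> bcarrier Y"
  shows "ext f = (\<Sum>p\<in>S. bscale Z (Poly_Mapping.lookup f p) (case_prod B p))"
  unfolding ext_def using assms
  by (intro sum.mono_neutral_left) (auto simp: in_keys_iff bscale_zero B_closed)

lemma ext_mem: "f \<in> free_carrier X Y \<Longrightarrow> ext f \<in> bcarrier Z"
  unfolding ext_def free_carrier_def
  by (intro sum_mem bscale_closed case_prod_B_closed) auto

lemma ext_plus:
  assumes "f \<in> free_carrier X Y" "g \<in> free_carrier X Y"
  shows "ext (f + g) = ext f + ext g"
proof -
  let ?S = "Poly_Mapping.keys f \<union> Poly_Mapping.keys g"
  have S: "finite ?S" "?S \<subseteq> bcarrier X \<times> bcarrier Y"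
    using assms by (auto simp: free_carrier_def)
  have "bscale Z (Poly_Mapping.lookup (f + g) p) (case_prod B p) =
     bscale Z (Poly_Mapping.lookup f p) (case_prod B p) + bscale Z (Poly_Mapping.lookup g p) (case_prod B p)"
    if "p \<in> ?S" for p
    using bscale_add_left[OF case_prod_B_closed[OF subsetD[OF S(2) that]]] by (simp add: lookup_add badd_plus)
  then show ?thesis
    using ext_superset[OF S(1) _ S(2)] Poly_Mapping.keys_add[of f g]
    by (simp add: sum.distrib)
qed

lemma ext_diff:
  assumes "f \<in> free_carrier X Y" "g \<in> free_carrier X Y"
  shows "ext (f - g) = ext f - ext g"
  using ext_plus[OF free_carrier_diff[OF assms] assms(2)] by simp

lemma ext_zero: "ext 0 = 0"
  by (simp add: ext_def)

lemma ext_scale: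
  assumes "f \<in> free_carrier X Y"
  shows "ext (free_scale c f) = bscale Z c (ext f)"
proof -
  have S: "finite (Poly_Mapping.keys f)" "Poly_Mapping.keys f \<subseteq> bcarrier X \<times> bcarrier Y"
    using assms by (auto simp: free_carrier_def)
  have "ext (free_scale c f) =
      (\<Sum>p\<in>Poly_Mapping.keys f. bscale Z c (bscale Z (Poly_Mapping.lookup f p) (case_prod B p)))"
    unfolding ext_superset[OF S(1) keys_free_scale S(2)] using S(2)
    by (intro sum.cong refl) (simp only: bscale_scale[OF case_prod_B_closed] lookup_free_scale subset_iff)
  also have "\<dots> = bscale Z c (ext f)"
    unfolding ext_def using S(2) by (intro bscale_sum[symmetric] bscale_closed case_prod_B_closed) auto
  finally show ?thesis .
qed

lemma ext_single:
  assumes "x \<in> bcarrier X" "y \<in> bcarrier Y"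
  shows "ext (Poly_Mapping.single (x, y) c) = bscale Z c (B x y)"
  using ext_superset[of "{(x, y)}" "Poly_Mapping.single (x, y) c"] assms by (simp add: lookup_single)

lemma ext_sum:
  "(\<And>i. i \<in> I \<Longrightarrow> f i \<in> free_carrier X Y) \<Longrightarrow> ext (sum f I) = (\<Sum>i\<in>I. ext (f i))"
  by (induction I rule: infinite_finite_induct) (auto simp: ext_zero ext_plus free_carrier_sum)

lemma free_carrier_left: "f \<in> free_carrier X Y \<Longrightarrow> a \<in> alg A \<Longrightarrow> free_left X a f \<in> free_carrier X Y"
  unfolding free_left_def
  by (rule free_carrier_sum) (auto simp: free_carrier_def X.bleft_closed split: if_splits)

lemma free_carrier_right: "f \<in> free_carrier X Y \<Longrightarrow> a \<in> alg A \<Longrightarrow> free_right Y f a \<in> free_carrier X Y"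
  unfolding free_right_def
  by (rule free_carrier_sum) (auto simp: free_carrier_def Y.bright_closed split: if_splits)

text \<open>The action may send different pairs to the same pair, so the keys of
  \<open>free_left X a f\<close> need not correspond to those of f. Additivity of \<open>ext\<close>
  over the defining sum avoids any look at those keys.\<close>

lemma ext_left:
  assumes f: "f \<in> free_carrier X Y" and a: "a \<in> alg A"
  shows "ext (free_left X a f) = bleft Z a (ext f)"
proof -
  have S: "x \<in> bcarrier X \<and> y \<in> bcarrier Y" if "(x, y) \<in> Poly_Mapping.keys f" for x y
    using f that by (auto simp: free_carrier_def)
  have "ext (free_left X a f) = (\<Sum>p\<in>Poly_Mapping.keys f. ext (case p of (x, y) \<Rightarrow>
      Poly_Mapping.single (bleft X a x, y) (Poly_Mapping.lookup f (x, y))))"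
    unfolding free_left_def using S a
    by (intro ext_sum) (auto intro!: free_carrier_single simp: X.bleft_closed)
  also have "\<dots> = (\<Sum>p\<in>Poly_Mapping.keys f. bleft Z a (bscale Z (Poly_Mapping.lookup f p) (case_prod B p)))"
    using S a by (intro sum.cong) (auto simp: ext_single X.bleft_closed B_left B_closed bleft_bscale)
  also have "\<dots> = bleft Z a (ext f)"
    unfolding ext_def using S a by (intro bleft_sum[symmetric] bscale_closed case_prod_B_closed) auto
  finally show ?thesis .
qed

lemma ext_right:
  assumes f: "f \<in> free_carrier X Y" and a: "a \<in> alg A"
  shows "ext (free_right Y f a) = bright Z (ext f) a"
proof -
  have S: "x \<in> bcarrier X \<and> y \<in> bcarrier Y" if "(x, y) \<in> Poly_Mapping.keys f" for x y
    using f that by (auto simp: free_carrier_def)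
  have "ext (free_right Y f a) = (\<Sum>p\<in>Poly_Mapping.keys f. ext (case p of (x, y) \<Rightarrow>
      Poly_Mapping.single (x, bright Y y a) (Poly_Mapping.lookup f (x, y))))"
    unfolding free_right_def using S a
    by (intro ext_sum) (auto intro!: free_carrier_single simp: Y.bright_closed)
  also have "\<dots> = (\<Sum>p\<in>Poly_Mapping.keys f. bright Z (bscale Z (Poly_Mapping.lookup f p) (case_prod B p)) a)"
    using S a by (intro sum.cong) (auto simp: ext_single Y.bright_closed B_right B_closed bright_scale_left)
  also have "\<dots> = bright Z (ext f) a"
    unfolding ext_def using S a by (intro bright_sum[symmetric] bscale_closed case_prod_B_closed) auto
  finally show ?thesis .
qed

text \<open>Sesquilinearity on both sides reduces this to elementary tensors, where
  \<open>B_inner\<close> applies. As a consequence the vectors of length zero in the free space are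
  exactly those that \<open>ext\<close> sends to 0.\<close>

lemma binner_ext:
  assumes f: "f \<in> free_carrier X Y" and g: "g \<in> free_carrier X Y"
  shows "binner Z (ext f) (ext g) = free_inner A X Y f g"
proof -
  have Sf: "p \<in> bcarrier X \<times> bcarrier Y" if "p \<in> Poly_Mapping.keys f" for p
    using f that by (auto simp: free_carrier_def)
  have Sg: "p \<in> bcarrier X \<times> bcarrier Y" if "p \<in> Poly_Mapping.keys g" for p
    using g that by (auto simp: free_carrier_def)
  have "binner Z (ext f) (ext g) = (\<Sum>p\<in>Poly_Mapping.keys f.
      binner Z (bscale Z (Poly_Mapping.lookup f p) (case_prod B p)) (ext g))"
    unfolding ext_def[of f] using Sf g
    by (intro binner_sum_left bscale_closed case_prod_B_closed ext_mem) auto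
  also have "\<dots> = (\<Sum>p\<in>Poly_Mapping.keys f. \<Sum>q\<in>Poly_Mapping.keys g.
      binner Z (bscale Z (Poly_Mapping.lookup f p) (case_prod B p))
        (bscale Z (Poly_Mapping.lookup g q) (case_prod B q)))"
    unfolding ext_def[of g] using Sf Sg
    by (intro sum.cong refl binner_sum_right bscale_closed case_prod_B_closed) auto
  also have "\<dots> = free_inner A X Y f g"
  proof -
    have "binner Z (bscale Z (Poly_Mapping.lookup f p) (case_prod B p))
        (bscale Z (Poly_Mapping.lookup g q) (case_prod B q)) =
      ascale A (cnj (Poly_Mapping.lookup f p) * Poly_Mapping.lookup g q)
        (binner Y (snd p) (bleft Y (binner X (fst p) (fst q)) (snd q)))"
      if "p \<in> Poly_Mapping.keys f" "q \<in> Poly_Mapping.keys g" for p q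
    proof -
      obtain x y x' y' where pq: "p = (x, y)" "q = (x', y')" by fastforce
      have m: "x \<in> bcarrier X" "y \<in> bcarrier Y" "x' \<in> bcarrier X" "y' \<in> bcarrier Y"
        using Sf[OF that(1)] Sg[OF that(2)] pq by auto
      then have "binner Z (B x y) (B x' y') \<in> alg A"
        by (intro binner_closed B_closed)
      then show ?thesis
        using m by (simp add: pq binner_scale binner_scale_left bscale_closed B_closed scale_scale
            mult.commute flip: B_inner)
    qed
    then show ?thesis
      unfolding free_inner_def case_prod_beta prod.collapse by (intro sum.cong refl) auto
  qed
  finally show ?thesis .
qed

lemma free_dist_eq:
  "\<lbrakk>f \<in> free_carrier X Y; g \<in> free_carrier X Y\<rbrakk> \<Longrightarrow> free_dist A X Y f g = bnorm A Z (ext f - ext g)"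
  by (simp add: free_dist_def bnorm_def free_carrier_diff ext_diff flip: binner_ext)

end

text \<open>Density of the range is expressed through \<open>ext\<close>, which exists only once the
  isometry is given; hence a second locale on top of the first.\<close>

locale tensor_realisation = inner_tensor_map A X Y Z B
  for A :: "('a::ring) star_algebra" and X :: "('a, 'x) bimodule" and Y :: "('a, 'y) bimodule"
    and Z :: "('a, 'z::ab_group_add) bimodule" and B :: "'x \<Rightarrow> 'y \<Rightarrow> 'z" +
  assumes ext_dense: "\<lbrakk>z \<in> bcarrier Z; \<epsilon> > 0\<rbrakk> \<Longrightarrow> \<exists>f\<in>free_carrier X Y. bnorm A Z (ext f - z) < \<epsilon>"
begin

text \<open>All representatives of one point of the completion at once. With the whole class at
  hand, each union over representatives in the definition of \<open>tensor\<close> becomes a union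
  of equal sets.\<close>

definition limit_class :: "'z \<Rightarrow> (nat \<Rightarrow> ('x \<times> 'y \<Rightarrow>\<^sub>0 complex)) set" where
  "limit_class z = {\<sigma>. range \<sigma> \<subseteq> free_carrier X Y \<and> converges (\<lambda>n. ext (\<sigma> n)) z}"

lemma limit_class_carrier: "\<sigma> \<in> limit_class z \<Longrightarrow> \<sigma> n \<in> free_carrier X Y"
  by (auto simp: limit_class_def)

lemma limit_class_converges: "\<sigma> \<in> limit_class z \<Longrightarrow> converges (\<lambda>n. ext (\<sigma> n)) z"
  by (simp add: limit_class_def)

lemma limit_classI: "(\<And>n. \<sigma> n \<in> free_carrier X Y) \<Longrightarrow> converges (\<lambda>n. ext (\<sigma> n)) z \<Longrightarrow> \<sigma> \<in> limit_class z"
  by (auto simp: limit_class_def)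

text \<open>Density provides approximants with error below 1/(n+1). Nonemptiness is what lets the
  unions over representatives be evaluated, and it makes different limits give different
  classes.\<close>

lemma limit_class_nonempty:
  assumes z: "z \<in> bcarrier Z"
  shows "limit_class z \<noteq> {}"
proof -
  have "\<exists>f\<in>free_carrier X Y. bnorm A Z (ext f - z) < 1 / real (Suc n)" for n
    using ext_dense[OF z, of "1 / real (Suc n)"] by simp
  then obtain \<sigma> where \<sigma>: "\<And>n. \<sigma> n \<in> free_carrier X Y"
    "\<And>n. bnorm A Z (ext (\<sigma> n) - z) < 1 / real (Suc n)" by metis
  have "converges (\<lambda>n. ext (\<sigma> n)) z"
    by (rule convergesI[OF _ z less_imp_le[OF \<sigma>(2)] LIMSEQ_Suc[OF lim_1_over_n]]) (simp add: ext_mem \<sigma>)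
  then show ?thesis using \<sigma>(1) by (auto intro: limit_classI)
qed

lemma limit_class_unique: "\<lbrakk>\<sigma> \<in> limit_class z; \<sigma> \<in> limit_class w; z \<in> bcarrier Z; w \<in> bcarrier Z\<rbrakk> \<Longrightarrow> z = w"
  by (rule converges_unique[of "\<lambda>n. ext (\<sigma> n)"]) (auto simp: limit_class_converges ext_mem limit_class_carrier)

lemma tensor_cauchy_iff:
  "\<sigma> \<in> tensor_cauchy A X Y \<longleftrightarrow> (\<forall>n. \<sigma> n \<in> free_carrier X Y) \<and>
     cauchy_wrt (\<lambda>x y. bnorm A Z (x - y)) (\<lambda>n. ext (\<sigma> n))"
  by (auto simp: tensor_cauchy_def cauchy_wrt_def free_dist_eq image_subset_iff)

lemma limit_class_cauchy: "\<sigma> \<in> limit_class z \<Longrightarrow> z \<in> bcarrier Z \<Longrightarrow> \<sigma> \<in> tensor_cauchy A X Y"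
  unfolding tensor_cauchy_iff by (auto simp: limit_class_carrier ext_mem intro!: converges_cauchy limit_class_converges)

lemma cauchy_limit_class:
  assumes "\<sigma> \<in> tensor_cauchy A X Y"
  obtains z where "z \<in> bcarrier Z" "\<sigma> \<in> limit_class z"
  using assms unfolding tensor_cauchy_iff by (metis limit_classI cauchy_converges ext_mem)

text \<open>By \<open>converges_diff_null\<close> a Cauchy sequence is related to \<sigma> exactly
  when its image has the limit z as well; a sequence that is not Cauchy belongs to neither
  side.\<close>

lemma tensor_rel_image:
  assumes "\<sigma> \<in> limit_class z" "z \<in> bcarrier Z"
  shows "tensor_rel A X Y `` {\<sigma>} = limit_class z"
proof -
  have "(\<sigma>, \<tau>) \<in> tensor_rel A X Y \<longleftrightarrow> \<tau> \<in> limit_class z" (is "?l \<longleftrightarrow> ?r") for \<tau>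
  proof (cases "\<tau> \<in> tensor_cauchy A X Y")
    case True
    then have \<tau>: "\<tau> n \<in> free_carrier X Y" for n by (simp add: tensor_cauchy_iff)
    then show ?thesis
      using converges_diff_null[OF _ _ assms(2) limit_class_converges[OF assms(1)], of "\<lambda>n. ext (\<tau> n)"] True
      by (auto simp: tensor_rel_def limit_class_cauchy[OF assms] free_dist_eq limit_class_carrier[OF assms(1)] ext_mem
          intro: limit_classI limit_class_converges)
  next
    case False
    then show ?thesis using limit_class_cauchy[OF _ assms(2)] by (auto simp: tensor_rel_def)
  qed
  then show ?thesis by auto
qed

text \<open>Completeness of Z gives every Cauchy sequence a limit, hence one inclusion; the other
  holds because each limit class has a member to generate it.\<close>

lemma tensor_carrier: "bcarrier (tensor A X Y) = limit_class ` bcarrier Z"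
proof -
  have "tensor_cauchy A X Y // tensor_rel A X Y = limit_class ` bcarrier Z"
  proof (intro equalityI subsetI)
    fix S assume "S \<in> tensor_cauchy A X Y // tensor_rel A X Y"
    then obtain \<sigma> where "\<sigma> \<in> tensor_cauchy A X Y" "S = tensor_rel A X Y `` {\<sigma>}" by (rule quotientE)
    then show "S \<in> limit_class ` bcarrier Z" by (metis cauchy_limit_class tensor_rel_image imageI)
  next
    fix S assume "S \<in> limit_class ` bcarrier Z"
    then obtain z where z: "z \<in> bcarrier Z" "S = limit_class z" by auto
    then obtain \<sigma> where "\<sigma> \<in> limit_class z" using limit_class_nonempty by blast
    then show "S \<in> tensor_cauchy A X Y // tensor_rel A X Y"
      using tensor_rel_image[of \<sigma> z] z quotientI[of \<sigma> "tensor_cauchy A X Y" "tensor_rel A X Y"]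
      by (simp add: limit_class_cauchy)
  qed
  then show ?thesis by (simp add: tensor_def Let_def)
qed

lemma inj_on_limit_class: "inj_on limit_class (bcarrier Z)"
  by (rule inj_onI) (metis limit_class_nonempty limit_class_unique ex_in_conv)

lemma tensor_add:
  assumes z: "z \<in> bcarrier Z" and w: "w \<in> bcarrier Z"
  shows "badd (tensor A X Y) (limit_class z) (limit_class w) = limit_class (z + w)"
proof -
  \<comment> \<open>The class obtained does not depend on the representatives, so the union over the
    nonempty sets of representatives collapses to it. The other operations are treated in the same
    way, each with its own continuity lemma.\<close>
  have "tensor_rel A X Y `` {\<lambda>n. \<sigma> n + \<tau> n} = limit_class (z + w)" if "\<sigma> \<in> limit_class z" "\<tau> \<in> limit_class w" for \<sigma> \<tau>
    using that z w
    by (intro tensor_rel_image limit_classI)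
      (auto simp: plus_closed ext_plus limit_class_carrier free_carrier_add ext_mem intro!: converges_add limit_class_converges)
  then show ?thesis
    using limit_class_nonempty[OF z] limit_class_nonempty[OF w] by (simp add: tensor_def Let_def)
qed

lemma tensor_scale:
  assumes z: "z \<in> bcarrier Z"
  shows "bscale (tensor A X Y) c (limit_class z) = limit_class (bscale Z c z)"
proof -
  have "tensor_rel A X Y `` {\<lambda>n. free_scale c (\<sigma> n)} = limit_class (bscale Z c z)" if "\<sigma> \<in> limit_class z" for \<sigma>
    using that z
    by (intro tensor_rel_image limit_classI)
      (auto simp: bscale_closed ext_scale limit_class_carrier free_carrier_scale ext_mem intro!: converges_bscale limit_class_converges)
  then show ?thesis
    using limit_class_nonempty[OF z] by (simp add: tensor_def Let_def)
qed

lemma tensor_bright: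
  assumes z: "z \<in> bcarrier Z" and a: "a \<in> alg A"
  shows "bright (tensor A X Y) (limit_class z) a = limit_class (bright Z z a)"
proof -
  have "tensor_rel A X Y `` {\<lambda>n. free_right Y (\<sigma> n) a} = limit_class (bright Z z a)" if "\<sigma> \<in> limit_class z" for \<sigma>
    using that z a
    by (intro tensor_rel_image limit_classI)
      (auto simp: bright_closed ext_right limit_class_carrier free_carrier_right ext_mem intro!: converges_bright limit_class_converges)
  then show ?thesis
    using limit_class_nonempty[OF z] by (simp add: tensor_def Let_def)
qed

lemma tensor_bleft:
  assumes z: "z \<in> bcarrier Z" and a: "a \<in> alg A"
  shows "bleft (tensor A X Y) a (limit_class z) = limit_class (bleft Z a z)"
proof -
  have "tensor_rel A X Y `` {\<lambda>n. free_left X a (\<sigma> n)} = limit_class (bleft Z a z)" if "\<sigma> \<in> limit_class z" for \<sigma>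
    using that z a
    by (intro tensor_rel_image limit_classI)
      (auto simp: bleft_closed ext_left limit_class_carrier free_carrier_left ext_mem intro!: converges_bleft limit_class_converges)
  then show ?thesis
    using limit_class_nonempty[OF z] by (simp add: tensor_def Let_def)
qed

lemma tensor_inner:
  assumes z: "z \<in> bcarrier Z" and w: "w \<in> bcarrier Z"
  shows "binner (tensor A X Y) (limit_class z) (limit_class w) = binner Z z w"
proof -
  have lim: "(\<lambda>n. anorm A (free_inner A X Y (\<sigma> n) (\<tau> n) - binner Z z w)) \<longlonglongrightarrow> 0"
    if "\<sigma> \<in> limit_class z" "\<tau> \<in> limit_class w" for \<sigma> \<tau>
    using converges_binner[OF _ _ z w limit_class_converges[OF that(1)] limit_class_converges[OF that(2)]]
      limit_class_carrier[OF that(1)] limit_class_carrier[OF that(2)]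
    by (simp add: binner_ext ext_mem)
  \<comment> \<open>Uniqueness in the description needs one actual pair of representatives: for
    empty classes every c would qualify.\<close>
  obtain \<sigma> \<tau> where \<sigma>\<tau>: "\<sigma> \<in> limit_class z" "\<tau> \<in> limit_class w" using limit_class_nonempty z w by blast
  have "(THE c. c \<in> alg A \<and> (\<forall>\<sigma>\<in>limit_class z. \<forall>\<tau>\<in>limit_class w.
      (\<lambda>n. anorm A (free_inner A X Y (\<sigma> n) (\<tau> n) - c)) \<longlonglongrightarrow> 0)) = binner Z z w"
  proof (rule the_equality)
    show "binner Z z w \<in> alg A \<and> (\<forall>\<sigma>\<in>limit_class z. \<forall>\<tau>\<in>limit_class w.
      (\<lambda>n. anorm A (free_inner A X Y (\<sigma> n) (\<tau> n) - binner Z z w)) \<longlonglongrightarrow> 0)"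
      using lim z w by (simp add: binner_closed)
  next
    fix c assume c: "c \<in> alg A \<and> (\<forall>\<sigma>\<in>limit_class z. \<forall>\<tau>\<in>limit_class w.
      (\<lambda>n. anorm A (free_inner A X Y (\<sigma> n) (\<tau> n) - c)) \<longlonglongrightarrow> 0)"
    have "free_inner A X Y (\<sigma> n) (\<tau> n) \<in> alg A" for n
      using limit_class_carrier[OF \<sigma>\<tau>(1)] limit_class_carrier[OF \<sigma>\<tau>(2)]
      by (simp add: ext_mem binner_closed flip: binner_ext)
    then show "c = binner Z z w"
      using limit_unique[of "\<lambda>n. free_inner A X Y (\<sigma> n) (\<tau> n)" c "binner Z z w"] c lim[OF \<sigma>\<tau>] \<sigma>\<tau> z w
      by (simp add: binner_closed)
  qed
  then show ?thesis by (simp add: tensor_def Let_def)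
qed

lemma bimodule_iso_limit_class: "bimodule_iso A Z (tensor A X Y) limit_class"
  unfolding bimodule_iso_def
  by (auto simp: bij_betw_def inj_on_limit_class tensor_carrier tensor_add tensor_scale tensor_bright tensor_bleft
      tensor_inner badd_plus)

lemma elem_tensor_limit_class: "\<lbrakk>x \<in> bcarrier X; y \<in> bcarrier Y\<rbrakk> \<Longrightarrow> elem_tensor A X Y x y = limit_class (B x y)"
  unfolding elem_tensor_def
  by (intro tensor_rel_image limit_classI)
    (auto simp: B_closed ext_single bscale_one converges_const free_carrier_single)

lemma tensor_inner_elem:
  "\<lbrakk>x \<in> bcarrier X; y \<in> bcarrier Y; x' \<in> bcarrier X; y' \<in> bcarrier Y\<rbrakk>
    \<Longrightarrow> binner (tensor A X Y) (elem_tensor A X Y x y) (elem_tensor A X Y x' y') =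
      binner Y y (bleft Y (binner X x x') y')"
  by (simp add: elem_tensor_limit_class tensor_inner B_closed B_inner)

lemma elem_tensor_mem:
  "\<lbrakk>x \<in> bcarrier X; y \<in> bcarrier Y\<rbrakk> \<Longrightarrow> elem_tensor A X Y x y \<in> bcarrier (tensor A X Y)"
  by (simp add: elem_tensor_limit_class tensor_carrier B_closed)

theorem tensor_iso:
  "\<exists>U. bimodule_iso A (tensor A X Y) Z U \<and>
    (\<forall>x\<in>bcarrier X. \<forall>y\<in>bcarrier Y. U (elem_tensor A X Y x y) = B x y)"
proof (intro exI conjI ballI)
  show "bimodule_iso A (tensor A X Y) Z (inv_into (bcarrier Z) limit_class)"
    by (rule bimodule_iso_inv[OF hilbert_bimodule_axioms bimodule_iso_limit_class])
qed (simp add: elem_tensor_limit_class inv_into_f_f[OF inj_on_limit_class] B_closed)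

end

section \<open>The C*-algebra of a discrete set\<close>

lemma vanishes_at_infinityD:
  "vanishes_at_infinity V f \<Longrightarrow> \<epsilon> > 0 \<Longrightarrow> finite {v \<in> V. norm (f v) \<ge> \<epsilon>}"
  by (simp add: vanishes_at_infinity_def)

lemma vanishes_at_infinity_dominated:
  assumes "vanishes_at_infinity V f" "vanishes_at_infinity V g"
    and "\<And>v. v \<in> V \<Longrightarrow> norm (h v) \<le> C * (norm (f v) + norm (g v))"
  shows "vanishes_at_infinity V h"
  unfolding vanishes_at_infinity_def
proof (intro allI impI)
  fix \<epsilon> :: real assume \<epsilon>: "\<epsilon> > 0"
  \<comment> \<open>The 2 divides \<epsilon> between the two functions; \<bar>C\<bar> + 1 in place
    of C keeps the denominator positive for every real C.\<close>
  define \<delta> where "\<delta> = \<epsilon> / (2 * (\<bar>C\<bar> + 1))"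
  have \<delta>: "\<delta> > 0" using \<epsilon> by (simp add: \<delta>_def)
  have "{v \<in> V. norm (h v) \<ge> \<epsilon>} \<subseteq> {v \<in> V. norm (f v) \<ge> \<delta>} \<union> {v \<in> V. norm (g v) \<ge> \<delta>}"
  proof (rule subsetI, rule ccontr)
    fix v assume v: "v \<in> {v \<in> V. norm (h v) \<ge> \<epsilon>}"
      and "v \<notin> {v \<in> V. norm (f v) \<ge> \<delta>} \<union> {v \<in> V. norm (g v) \<ge> \<delta>}"
    then have less: "norm (f v) + norm (g v) < 2 * \<delta>" by auto
    have "norm (h v) \<le> C * (norm (f v) + norm (g v))" using assms(3) v by simp
    also have "\<dots> \<le> (\<bar>C\<bar> + 1) * (norm (f v) + norm (g v))" by (intro mult_right_mono) auto
    also have "\<dots> < (\<bar>C\<bar> + 1) * (2 * \<delta>)" using less by (intro mult_strict_left_mono) auto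
    also have "\<dots> = \<epsilon>" using abs_ge_zero[of C] by (simp add: \<delta>_def field_simps add_pos_nonneg)
    finally show False using v by simp
  qed
  then show "finite {v \<in> V. norm (h v) \<ge> \<epsilon>}"
    by (rule finite_subset) (use assms(1,2) \<delta> in \<open>auto dest: vanishes_at_infinityD\<close>)
qed

lemma C0_iff: "f \<in> alg (C0 V) \<longleftrightarrow> (\<forall>v. v \<notin> V \<longrightarrow> f v = 0) \<and> vanishes_at_infinity V f"
  by (simp add: C0_def)

lemma C0_simps:
  "ascale (C0 V) = (\<lambda>c f v. c * f v)" "astar (C0 V) = (\<lambda>f v. cnj (f v))"
  "anorm (C0 V) = (\<lambda>f. SUP v. cmod (f v))"
  by (simp_all add: C0_def)

text \<open>Only finitely many values have modulus at least 1, so 1 plus the sum of these moduli is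
  a bound. The supremum that defines the norm is meaningful only because of it.\<close>

lemma C0_bdd_above:
  assumes "f \<in> alg (C0 V)"
  shows "bdd_above (range (\<lambda>v. cmod (f v)))"
proof -
  let ?S = "{v \<in> V. cmod (f v) \<ge> 1}"
  have fin: "finite ?S" using assms vanishes_at_infinityD[of V f 1] by (simp add: C0_iff)
  have "cmod (f v) \<le> 1 + (\<Sum>v\<in>?S. cmod (f v))" for v
  proof (cases "v \<in> ?S")
    case True
    then have "cmod (f v) \<le> (\<Sum>v\<in>?S. cmod (f v))"
      using fin by (intro member_le_sum) auto
    then show ?thesis by simp
  next
    case False
    then have "cmod (f v) \<le> 1" using assms by (cases "v \<in> V") (auto simp: C0_iff)
    moreover have "0 \<le> (\<Sum>v\<in>?S. cmod (f v))" by (intro sum_nonneg) auto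
    ultimately show ?thesis by simp
  qed
  then show ?thesis by (intro bdd_aboveI2)
qed

lemma C0_norm_upper: "f \<in> alg (C0 V) \<Longrightarrow> cmod (f v) \<le> anorm (C0 V) f"
  unfolding C0_simps by (rule cSUP_upper[OF UNIV_I C0_bdd_above])

lemma C0_norm_least: "(\<And>v. cmod (f v) \<le> b) \<Longrightarrow> anorm (C0 V) f \<le> b"
  unfolding C0_simps by (rule cSUP_least) auto

lemma C0_norm_nonneg: "f \<in> alg (C0 V) \<Longrightarrow> 0 \<le> anorm (C0 V) f"
  using C0_norm_upper[of f V] norm_ge_zero order_trans by blast

lemma C0_dominated:
  assumes "f \<in> alg (C0 V)" "g \<in> alg (C0 V)" "\<And>v. cmod (h v) \<le> C * (cmod (f v) + cmod (g v))"
  shows "h \<in> alg (C0 V)"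
proof -
  have "h v = 0" if "v \<notin> V" for v
    using assms(3)[of v] assms(1,2) that by (simp add: C0_iff)
  then show ?thesis
    using assms vanishes_at_infinity_dominated[of V f g h C] by (auto simp: C0_iff)
qed

lemma C0_add: "f \<in> alg (C0 V) \<Longrightarrow> g \<in> alg (C0 V) \<Longrightarrow> f + g \<in> alg (C0 V)"
  by (rule C0_dominated[of f V g _ 1]) (auto simp: norm_triangle_ineq)

lemma C0_mult:
  assumes "f \<in> alg (C0 V)" "g \<in> alg (C0 V)"
  shows "f * g \<in> alg (C0 V)"
proof (rule C0_dominated[OF assms, of _ "anorm (C0 V) f"])
  fix v
  have "cmod (f v) * cmod (g v) \<le> anorm (C0 V) f * (cmod (f v) + cmod (g v))"
    using C0_norm_upper[OF assms(1)] by (intro mult_mono) (auto simp: C0_norm_nonneg assms)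
  then show "cmod ((f * g) v) \<le> anorm (C0 V) f * (cmod (f v) + cmod (g v))"
    by (simp add: norm_mult)
qed

lemma C0_scale: "f \<in> alg (C0 V) \<Longrightarrow> (\<lambda>v. c * f v) \<in> alg (C0 V)"
  by (rule C0_dominated[of f V f _ "cmod c"])
    (auto simp: norm_mult intro!: mult_left_mono)

lemma C0_star: "f \<in> alg (C0 V) \<Longrightarrow> (\<lambda>v. cnj (f v)) \<in> alg (C0 V)"
  by (rule C0_dominated[of f V f _ 1]) auto

lemma C0_zero: "0 \<in> alg (C0 V)"
  by (simp add: C0_iff vanishes_at_infinity_def)

lemma C0_diff: "f \<in> alg (C0 V) \<Longrightarrow> g \<in> alg (C0 V) \<Longrightarrow> f - g \<in> alg (C0 V)"
  by (rule C0_dominated[of f V g _ 1]) (auto simp: norm_triangle_ineq4)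

lemma cauchy_wrt_dominated:
  assumes "cauchy_wrt d \<sigma>" "\<And>m n. norm (f m - f n) \<le> d (\<sigma> m) (\<sigma> n)"
  shows "Cauchy (f :: nat \<Rightarrow> complex)"
  using assms unfolding cauchy_wrt_def
  by (intro CauchyI) (meson le_less_trans)

lemma C0_complete: "complete_wrt (\<lambda>a b. anorm (C0 V) (a - b)) (alg (C0 V))"
  unfolding complete_wrt_def
proof (intro allI impI, elim conjE)
  fix \<sigma> :: "nat \<Rightarrow> 'a \<Rightarrow> complex"
  assume "range \<sigma> \<subseteq> alg (C0 V)" and cau: "cauchy_wrt (\<lambda>a b. anorm (C0 V) (a - b)) \<sigma>"
  then have mem: "\<sigma> n \<in> alg (C0 V)" for n by auto
  have up: "cmod (\<sigma> m v - \<sigma> n v) \<le> anorm (C0 V) (\<sigma> m - \<sigma> n)" for m n v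
    using C0_norm_upper[OF C0_diff[OF mem mem], of m n v] by simp
  have "\<exists>c. (\<lambda>n. \<sigma> n v) \<longlonglongrightarrow> c" for v
    using cauchy_wrt_dominated[OF cau, of "\<lambda>n. \<sigma> n v"] up by (simp add: Cauchy_convergent_iff convergent_def)
  then obtain f where f: "\<And>v. (\<lambda>n. \<sigma> n v) \<longlonglongrightarrow> f v" by metis
  have close: "\<exists>N. \<forall>n\<ge>N. \<forall>v. cmod (\<sigma> n v - f v) \<le> \<epsilon>" if \<epsilon>: "\<epsilon> > 0" for \<epsilon>
  proof -
    obtain N where N: "\<And>m n. m \<ge> N \<Longrightarrow> n \<ge> N \<Longrightarrow> anorm (C0 V) (\<sigma> m - \<sigma> n) < \<epsilon>"
      using cau \<epsilon> unfolding cauchy_wrt_def by blast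
    \<comment> \<open>The index m tends to infinity in the Cauchy estimate at a fixed v. Since N
      does not depend on v, pointwise convergence becomes uniform.\<close>
    have "cmod (\<sigma> n v - f v) \<le> \<epsilon>" if n: "n \<ge> N" for n v
    proof (rule LIMSEQ_le_const2)
      show "(\<lambda>m. cmod (\<sigma> n v - \<sigma> m v)) \<longlonglongrightarrow> cmod (\<sigma> n v - f v)"
        by (intro tendsto_norm tendsto_diff tendsto_const f)
      show "\<exists>M. \<forall>m\<ge>M. cmod (\<sigma> n v - \<sigma> m v) \<le> \<epsilon>"
        using up N[OF n] by (meson less_imp_le order_trans)
    qed
    then show ?thesis by blast
  qed
  have fV: "f v = 0" if "v \<notin> V" for v
  proof -
    have "(\<lambda>n. \<sigma> n v) = (\<lambda>n. 0)" using mem that by (auto simp: C0_iff)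
    then show ?thesis using f[of v] by (simp add: LIMSEQ_const_iff)
  qed
  have "vanishes_at_infinity V f"
    unfolding vanishes_at_infinity_def
  proof (intro allI impI)
    fix \<epsilon> :: real assume \<epsilon>: "\<epsilon> > 0"
    then obtain N where N: "\<And>v. cmod (\<sigma> N v - f v) \<le> \<epsilon>/2"
      using close[of "\<epsilon>/2"] by auto
    have "cmod (\<sigma> N v) \<ge> \<epsilon>/2" if "cmod (f v) \<ge> \<epsilon>" for v
      using norm_triangle_ineq2[of "f v" "\<sigma> N v"] N[of v] that by (simp add: norm_minus_commute)
    then have "{v \<in> V. cmod (f v) \<ge> \<epsilon>} \<subseteq> {v \<in> V. cmod (\<sigma> N v) \<ge> \<epsilon>/2}" by auto
    then show "finite {v \<in> V. cmod (f v) \<ge> \<epsilon>}"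
      by (rule finite_subset) (rule vanishes_at_infinityD, use mem[of N] \<epsilon> in \<open>auto simp: C0_iff\<close>)
  qed
  with fV have fmem: "f \<in> alg (C0 V)" by (simp add: C0_iff)
  have "(\<lambda>n. anorm (C0 V) (\<sigma> n - f)) \<longlonglongrightarrow> 0"
  proof (rule LIMSEQ_I)
    fix r :: real assume "r > 0"
    then obtain N where N: "\<And>n v. n \<ge> N \<Longrightarrow> cmod (\<sigma> n v - f v) \<le> r/2"
      using close[of "r/2"] by auto
    then have "anorm (C0 V) (\<sigma> n - f) \<le> r/2" if "n \<ge> N" for n
      using that by (intro C0_norm_least) simp
    then have "norm (anorm (C0 V) (\<sigma> n - f) - 0) < r" if "n \<ge> N" for n
      using C0_norm_nonneg[OF C0_diff[OF mem fmem], of n] that \<open>r > 0\<close> by fastforce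
    then show "\<exists>N. \<forall>n\<ge>N. norm (anorm (C0 V) (\<sigma> n - f) - 0) < r" by blast
  qed
  with fmem show "\<exists>x\<in>alg (C0 V). (\<lambda>n. anorm (C0 V) (\<sigma> n - x)) \<longlonglongrightarrow> 0" by blast
qed

lemma C0_norm_scale:
  assumes f: "f \<in> alg (C0 V)"
  shows "anorm (C0 V) (\<lambda>v. c * f v) = cmod c * anorm (C0 V) f"
proof (cases "c = 0")
  case True
  then show ?thesis by (simp add: C0_simps)
next
  case False
  show ?thesis
  proof (rule antisym)
    show "anorm (C0 V) (\<lambda>v. c * f v) \<le> cmod c * anorm (C0 V) f"
      by (rule C0_norm_least) (auto simp: norm_mult intro!: mult_left_mono C0_norm_upper[OF f])
    have "anorm (C0 V) f \<le> anorm (C0 V) (\<lambda>v. c * f v) / cmod c"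
    proof (rule C0_norm_least)
      fix v
      show "cmod (f v) \<le> anorm (C0 V) (\<lambda>v. c * f v) / cmod c"
        using C0_norm_upper[OF C0_scale[OF f], of c v] False
        by (simp add: norm_mult field_simps)
    qed
    then show "cmod c * anorm (C0 V) f \<le> anorm (C0 V) (\<lambda>v. c * f v)"
      using False by (simp add: field_simps)
  qed
qed

lemma C0_cstar_identity:
  assumes f: "f \<in> alg (C0 V)"
  shows "anorm (C0 V) ((\<lambda>v. cnj (f v)) * f) = (anorm (C0 V) f)\<^sup>2"
proof (rule antisym)
  have mem: "(\<lambda>v. cnj (f v)) * f \<in> alg (C0 V)" by (intro C0_mult C0_star f)
  show "anorm (C0 V) ((\<lambda>v. cnj (f v)) * f) \<le> (anorm (C0 V) f)\<^sup>2"
    using C0_norm_upper[OF f]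
    by (intro C0_norm_least) (auto simp: norm_mult power2_eq_square intro!: mult_mono C0_norm_nonneg f)
  have "anorm (C0 V) f \<le> sqrt (anorm (C0 V) ((\<lambda>v. cnj (f v)) * f))"
  proof (rule C0_norm_least)
    fix v
    show "cmod (f v) \<le> sqrt (anorm (C0 V) ((\<lambda>v. cnj (f v)) * f))"
      using C0_norm_upper[OF mem, of v] by (intro real_le_rsqrt) (simp add: norm_mult power2_eq_square)
  qed
  then show "(anorm (C0 V) f)\<^sup>2 \<le> anorm (C0 V) ((\<lambda>v. cnj (f v)) * f)"
    using C0_norm_nonneg[OF mem] C0_norm_nonneg[OF f] by (metis power_mono real_sqrt_pow2)
qed

theorem cstar_algebra_C0: "cstar_algebra (C0 V)"
proof
  fix f g :: "'a \<Rightarrow> complex" assume f: "f \<in> alg (C0 V)" and g: "g \<in> alg (C0 V)"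
  show "anorm (C0 V) (f + g) \<le> anorm (C0 V) f + anorm (C0 V) g"
  proof (rule C0_norm_least)
    fix v
    show "cmod ((f + g) v) \<le> anorm (C0 V) f + anorm (C0 V) g"
      using norm_triangle_ineq[of "f v" "g v"] C0_norm_upper[OF f, of v] C0_norm_upper[OF g, of v] by simp
  qed
  show "anorm (C0 V) (f * g) \<le> anorm (C0 V) f * anorm (C0 V) g"
    using C0_norm_upper[OF f] C0_norm_upper[OF g]
    by (intro C0_norm_least) (auto simp: norm_mult intro!: mult_mono C0_norm_nonneg f)
next
  fix f :: "'a \<Rightarrow> complex" assume f: "f \<in> alg (C0 V)"
  show "anorm (C0 V) f = 0 \<longleftrightarrow> f = 0"
  proof
    assume "anorm (C0 V) f = 0"
    then show "f = 0" using C0_norm_upper[OF f] by (auto simp: fun_eq_iff)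
  qed (simp add: C0_simps)
  show "anorm (C0 V) (astar (C0 V) f * f) = (anorm (C0 V) f)\<^sup>2"
    using C0_cstar_identity[OF f] by (simp add: C0_simps(2))
qed (auto simp: C0_zero C0_add C0_mult C0_norm_nonneg C0_complete C0_simps(1,2) C0_scale C0_star
    C0_norm_scale C0_cstar_identity fun_eq_iff algebra_simps)

section \<open>Square summable families\<close>

abbreviation sq_summable_on :: "('e \<Rightarrow> complex) \<Rightarrow> 'e set \<Rightarrow> bool" (infix "sq'_summable'_on" 50) where
  "x sq_summable_on S \<equiv> (\<lambda>l. (cmod (x l))\<^sup>2) summable_on S"

lemma cmod_add_power2_le: "(cmod (a + b))\<^sup>2 \<le> 2 * (cmod a)\<^sup>2 + 2 * (cmod b)\<^sup>2"
proof -
  have "(cmod (a + b))\<^sup>2 \<le> (cmod a + cmod b)\<^sup>2"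
    by (intro power_mono norm_triangle_ineq) auto
  also have "\<dots> \<le> 2 * (cmod a)\<^sup>2 + 2 * (cmod b)\<^sup>2"
    using zero_le_power2[of "cmod a - cmod b"] by (simp add: power2_sum power2_diff)
  finally show ?thesis .
qed

lemma sq_summable_add:
  assumes "x sq_summable_on S" "y sq_summable_on S"
  shows "(x + y) sq_summable_on S"
    and "(\<Sum>\<^sub>\<infinity>l\<in>S. (cmod ((x + y) l))\<^sup>2) \<le> 2 * (\<Sum>\<^sub>\<infinity>l\<in>S. (cmod (x l))\<^sup>2) + 2 * (\<Sum>\<^sub>\<infinity>l\<in>S. (cmod (y l))\<^sup>2)"
proof -
  have sx: "(\<lambda>l. 2 * (cmod (x l))\<^sup>2) summable_on S" and sy: "(\<lambda>l. 2 * (cmod (y l))\<^sup>2) summable_on S"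
    using assms by (auto intro: summable_on_cmult_right)
  show s: "(x + y) sq_summable_on S"
    by (rule summable_on_comparison_test[OF summable_on_add[OF sx sy]]) (auto simp: cmod_add_power2_le)
  have "(\<Sum>\<^sub>\<infinity>l\<in>S. (cmod ((x + y) l))\<^sup>2) \<le> (\<Sum>\<^sub>\<infinity>l\<in>S. 2 * (cmod (x l))\<^sup>2 + 2 * (cmod (y l))\<^sup>2)"
    by (rule infsum_mono[OF s summable_on_add[OF sx sy]]) (auto simp: cmod_add_power2_le)
  then show "(\<Sum>\<^sub>\<infinity>l\<in>S. (cmod ((x + y) l))\<^sup>2) \<le> 2 * (\<Sum>\<^sub>\<infinity>l\<in>S. (cmod (x l))\<^sup>2) + 2 * (\<Sum>\<^sub>\<infinity>l\<in>S. (cmod (y l))\<^sup>2)"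
    by (simp add: infsum_add[OF sx sy] infsum_cmult_right')
qed

lemma sq_summable_product:
  assumes "x sq_summable_on S" "y sq_summable_on S"
  shows "(\<lambda>l. norm (cnj (x l) * y l)) summable_on S"
proof (rule Infinite_Sum.abs_summable_on_comparison_test')
  show "(\<lambda>l. (cmod (x l))\<^sup>2 + (cmod (y l))\<^sup>2) summable_on S"
    using assms by (rule summable_on_add)
  show "norm (cnj (x l) * y l) \<le> (cmod (x l))\<^sup>2 + (cmod (y l))\<^sup>2" for l
    using zero_le_power2[of "cmod (x l) - cmod (y l)"] zero_le_power2[of "cmod (x l)"] zero_le_power2[of "cmod (y l)"]
    unfolding power2_diff norm_mult complex_mod_cnj by linarith
qed

text \<open>The finite inequality bounds every partial sum of the absolute values by a quantity
  independent of the finite set, and therefore the infinite sum.\<close>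

lemma sq_summable_cauchy_schwarz:
  assumes "x sq_summable_on S" "y sq_summable_on S"
  shows "cmod (\<Sum>\<^sub>\<infinity>l\<in>S. cnj (x l) * y l) \<le>
    sqrt (\<Sum>\<^sub>\<infinity>l\<in>S. (cmod (x l))\<^sup>2) * sqrt (\<Sum>\<^sub>\<infinity>l\<in>S. (cmod (y l))\<^sup>2)"
proof -
  have "cmod (\<Sum>\<^sub>\<infinity>l\<in>S. cnj (x l) * y l) \<le> (\<Sum>\<^sub>\<infinity>l\<in>S. norm (cnj (x l) * y l))"
    by (rule norm_infsum_bound[OF sq_summable_product[OF assms]])
  also have "\<dots> \<le> sqrt (\<Sum>\<^sub>\<infinity>l\<in>S. (cmod (x l))\<^sup>2) * sqrt (\<Sum>\<^sub>\<infinity>l\<in>S. (cmod (y l))\<^sup>2)"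
  proof (rule infsum_le_finite_sums[OF sq_summable_product[OF assms]])
    fix F assume F: "finite F" "F \<subseteq> S"
    have "(\<Sum>l\<in>F. norm (cnj (x l) * y l)) \<le> L2_set (\<lambda>l. cmod (x l)) F * L2_set (\<lambda>l. cmod (y l)) F"
      using L2_set_mult_ineq[of "\<lambda>l. cmod (x l)" "\<lambda>l. cmod (y l)" F] by (simp add: norm_mult)
    also have "\<dots> \<le> sqrt (\<Sum>\<^sub>\<infinity>l\<in>S. (cmod (x l))\<^sup>2) * sqrt (\<Sum>\<^sub>\<infinity>l\<in>S. (cmod (y l))\<^sup>2)"
      unfolding L2_set_def using F assms
      by (intro mult_mono real_sqrt_le_mono finite_sum_le_infsum)
        (auto intro!: sum_nonneg infsum_nonneg)
    finally show "(\<Sum>l\<in>F. norm (cnj (x l) * y l)) \<le>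
      sqrt (\<Sum>\<^sub>\<infinity>l\<in>S. (cmod (x l))\<^sup>2) * sqrt (\<Sum>\<^sub>\<infinity>l\<in>S. (cmod (y l))\<^sup>2)" .
  qed
  finally show ?thesis .
qed

section \<open>Cuntz-Krieger bimodules\<close>

text \<open>The value of <x, x> at v as a real number, so that it can be compared and estimated
  without passing through complex sums.\<close>

definition ck_sq :: "('v, 'e) pre_digraph \<Rightarrow> ('e \<Rightarrow> complex) \<Rightarrow> 'v \<Rightarrow> real" where
  "ck_sq G x v = (\<Sum>\<^sub>\<infinity>l\<in>in_arcs G v. (cmod (x l))\<^sup>2)"

lemma ck_sq_nonneg: "0 \<le> ck_sq G x v"
  unfolding ck_sq_def by (rule infsum_nonneg) auto

lemma ck_simps:
  "badd (ck_bimodule G) = (+)" "bzero (ck_bimodule G) = 0"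
  "bscale (ck_bimodule G) = (\<lambda>c x l. c * x l)"
  "bright (ck_bimodule G) = (\<lambda>x a l. x l * a (head G l))"
  "bleft (ck_bimodule G) = (\<lambda>a x l. a (tail G l) * x l)"
  "binner (ck_bimodule G) = (\<lambda>x y v. \<Sum>\<^sub>\<infinity>l\<in>in_arcs G v. cnj (x l) * y l)"
  by (simp_all add: ck_bimodule_def in_arcs_def)

context wf_digraph
begin

lemma in_arcs_empty: "v \<notin> verts G \<Longrightarrow> in_arcs G v = {}"
  by (auto simp: in_arcs_def)

text \<open>No arc ends outside the vertex set, so summability can be stated at every v; later sums
  over \<open>in_arcs\<close> then carry no side condition on v.\<close>

lemma ck_iff: "x \<in> bcarrier (ck_bimodule G) \<longleftrightarrow> (\<forall>l. l \<notin> arcs G \<longrightarrow> x l = 0) \<and>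
    (\<forall>v. x sq_summable_on in_arcs G v) \<and> vanishes_at_infinity (verts G) (ck_sq G x)"
proof -
  have "x sq_summable_on in_arcs G v" if "v \<notin> verts G" for v
    using in_arcs_empty[OF that] by simp
  then show ?thesis by (auto simp: ck_bimodule_def in_arcs_def ck_sq_def[abs_def])
qed

lemma ckD:
  assumes "x \<in> bcarrier (ck_bimodule G)"
  shows "l \<notin> arcs G \<Longrightarrow> x l = 0" "x sq_summable_on in_arcs G v"
    "vanishes_at_infinity (verts G) (ck_sq G x)"
  using assms by (auto simp: ck_iff)

lemma ck_sq_zero: "v \<notin> verts G \<Longrightarrow> ck_sq G x v = 0"
  by (simp add: ck_sq_def in_arcs_empty)

lemma ck_sq_C0:
  "x \<in> bcarrier (ck_bimodule G) \<Longrightarrow> (\<lambda>v. complex_of_real (ck_sq G x v)) \<in> alg (C0 (verts G))"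
  by (auto simp: C0_iff ck_iff ck_sq_zero vanishes_at_infinity_def)

lemma cmod_le_ck_sq:
  assumes "x \<in> bcarrier (ck_bimodule G)" "l \<in> arcs G"
  shows "(cmod (x l))\<^sup>2 \<le> ck_sq G x (head G l)"
  using finite_sum_le_infsum[OF ckD(2)[OF assms(1)], of "{l}" "head G l"] assms(2)
  by (simp add: ck_sq_def in_arcs_def)

lemma ck_inner_self:
  assumes "x \<in> bcarrier (ck_bimodule G)"
  shows "binner (ck_bimodule G) x x = (\<lambda>v. complex_of_real (ck_sq G x v))"
proof
  fix v
  have "((\<lambda>l. complex_of_real ((cmod (x l))\<^sup>2)) has_sum complex_of_real (ck_sq G x v)) (in_arcs G v)"
    unfolding ck_sq_def by (intro has_sum_of_real has_sum_infsum ckD(2) assms)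
  then have "((\<lambda>l. cnj (x l) * x l) has_sum complex_of_real (ck_sq G x v)) (in_arcs G v)"
    by (simp only: complex_norm_square mult.commute)
  then show "binner (ck_bimodule G) x x v = complex_of_real (ck_sq G x v)"
    by (simp add: ck_simps infsumI)
qed

lemma ck_inner_summable:
  "x \<in> bcarrier (ck_bimodule G) \<Longrightarrow> y \<in> bcarrier (ck_bimodule G)
    \<Longrightarrow> (\<lambda>l. cnj (x l) * y l) summable_on in_arcs G v"
  by (rule abs_summable_summable) (rule sq_summable_product[OF ckD(2) ckD(2)])

lemma ck_inner_bound:
  assumes "x \<in> bcarrier (ck_bimodule G)" "y \<in> bcarrier (ck_bimodule G)"
  shows "cmod (binner (ck_bimodule G) x y v) \<le> sqrt (ck_sq G x v) * sqrt (ck_sq G y v)"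
  unfolding ck_simps ck_sq_def by (intro sq_summable_cauchy_schwarz ckD(2) assms)

text \<open>Cauchy-Schwarz bounds the value at v by a geometric mean, and this by the sum of the two
  functions <x, x> and <y, y>, which already lie in the algebra.\<close>

lemma ck_inner_closed:
  assumes "x \<in> bcarrier (ck_bimodule G)" "y \<in> bcarrier (ck_bimodule G)"
  shows "binner (ck_bimodule G) x y \<in> alg (C0 (verts G))"
proof (rule C0_dominated[OF ck_sq_C0[OF assms(1)] ck_sq_C0[OF assms(2)], of _ 1])
  fix v
  have "sqrt (ck_sq G x v) * sqrt (ck_sq G y v) \<le> ck_sq G x v + ck_sq G y v"
    using arith_geo_mean_sqrt[OF ck_sq_nonneg ck_sq_nonneg, of G x v G y v]
      ck_sq_nonneg[of G x v] ck_sq_nonneg[of G y v] by (simp add: real_sqrt_mult)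
  then show "cmod (binner (ck_bimodule G) x y v) \<le>
      1 * (cmod (complex_of_real (ck_sq G x v)) + cmod (complex_of_real (ck_sq G y v)))"
    using ck_inner_bound[OF assms, of v] ck_sq_nonneg[of G x v] ck_sq_nonneg[of G y v] by simp
qed

lemma ck_bnorm:
  assumes "x \<in> bcarrier (ck_bimodule G)"
  shows "bnorm (C0 (verts G)) (ck_bimodule G) x =
    sqrt (anorm (C0 (verts G)) (\<lambda>v. complex_of_real (ck_sq G x v)))"
  by (simp add: bnorm_def ck_inner_self[OF assms])

lemma ck_bnorm_nonneg:
  "x \<in> bcarrier (ck_bimodule G) \<Longrightarrow> 0 \<le> bnorm (C0 (verts G)) (ck_bimodule G) x"
  by (simp add: ck_bnorm C0_norm_nonneg ck_sq_C0)

lemma ck_sq_le_bnorm: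
  assumes "x \<in> bcarrier (ck_bimodule G)"
  shows "ck_sq G x v \<le> (bnorm (C0 (verts G)) (ck_bimodule G) x)\<^sup>2"
  using C0_norm_upper[OF ck_sq_C0[OF assms], of v] C0_norm_nonneg[OF ck_sq_C0[OF assms]]
  by (simp add: ck_bnorm[OF assms] ck_sq_nonneg)

lemma ck_bnorm_le:
  assumes "x \<in> bcarrier (ck_bimodule G)" "0 \<le> b" "\<And>v. ck_sq G x v \<le> b\<^sup>2"
  shows "bnorm (C0 (verts G)) (ck_bimodule G) x \<le> b"
  unfolding ck_bnorm[OF assms(1)] using assms(2,3)
  by (intro real_le_lsqrt C0_norm_least) (auto simp: ck_sq_nonneg)

lemma ckI_dominated:
  assumes "x \<in> bcarrier (ck_bimodule G)" "y \<in> bcarrier (ck_bimodule G)"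
    and "\<And>l. l \<notin> arcs G \<Longrightarrow> z l = 0" "\<And>v. z sq_summable_on in_arcs G v"
    and "\<And>v. ck_sq G z v \<le> C * (ck_sq G x v + ck_sq G y v)"
  shows "z \<in> bcarrier (ck_bimodule G)"
  using vanishes_at_infinity_dominated[OF ckD(3)[OF assms(1)] ckD(3)[OF assms(2)], of "ck_sq G z" C] assms(3-5)
  by (simp add: ck_iff ck_sq_nonneg)

text \<open>Scalars, the right action and the left action all multiply by a bounded function of the
  edge: a constant, a function of the range, a function of the source. This one estimate serves all
  three.\<close>

lemma ck_bounded_multiple:
  assumes x: "x \<in> bcarrier (ck_bimodule G)" and M: "\<And>l. cmod (b l) \<le> M"
  shows "(\<lambda>l. b l * x l) \<in> bcarrier (ck_bimodule G)"
    and "ck_sq G (\<lambda>l. b l * x l) v \<le> M\<^sup>2 * ck_sq G x v"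
proof -
  have le: "(cmod (b l * x l))\<^sup>2 \<le> M\<^sup>2 * (cmod (x l))\<^sup>2" for l
    using power_mono[OF M[of l] norm_ge_zero, of 2]
    by (auto simp: norm_mult power_mult_distrib intro: mult_right_mono)
  have sM: "(\<lambda>l. M\<^sup>2 * (cmod (x l))\<^sup>2) summable_on in_arcs G v" for v
    by (intro summable_on_cmult_right ckD(2) x)
  have s: "(\<lambda>l. b l * x l) sq_summable_on in_arcs G v" for v
    by (rule summable_on_comparison_test[OF sM]) (use le in auto)
  have sq: "ck_sq G (\<lambda>l. b l * x l) v \<le> M\<^sup>2 * ck_sq G x v" for v
    unfolding ck_sq_def infsum_cmult_right'[symmetric] by (rule infsum_mono[OF s sM le])
  show "(\<lambda>l. b l * x l) \<in> bcarrier (ck_bimodule G)"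
  proof (rule ckI_dominated[OF x x _ s])
    show "ck_sq G (\<lambda>l. b l * x l) v \<le> M\<^sup>2 * (ck_sq G x v + ck_sq G x v)" for v
      using sq[of v] mult_nonneg_nonneg[OF zero_le_power2[of M] ck_sq_nonneg[of G x v]]
      by (simp add: distrib_left)
  qed (simp add: ckD(1)[OF x])
  show "ck_sq G (\<lambda>l. b l * x l) v \<le> M\<^sup>2 * ck_sq G x v" by (rule sq)
qed

lemma ck_zero: "0 \<in> bcarrier (ck_bimodule G)"
  by (simp add: ck_iff vanishes_at_infinity_def ck_sq_def)

lemma ck_scale: "x \<in> bcarrier (ck_bimodule G) \<Longrightarrow> (\<lambda>l. c * x l) \<in> bcarrier (ck_bimodule G)"
  by (rule ck_bounded_multiple[of x "\<lambda>_. c" "cmod c"]) auto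

lemma ck_add:
  assumes "x \<in> bcarrier (ck_bimodule G)" "y \<in> bcarrier (ck_bimodule G)"
  shows "x + y \<in> bcarrier (ck_bimodule G)"
proof (rule ckI_dominated[OF assms])
  show "(x + y) sq_summable_on in_arcs G v" for v
    by (intro sq_summable_add(1) ckD(2) assms)
  show "ck_sq G (x + y) v \<le> 2 * (ck_sq G x v + ck_sq G y v)" for v
    using sq_summable_add(2)[OF ckD(2)[OF assms(1)] ckD(2)[OF assms(2)], of v]
    by (simp add: ck_sq_def)
qed (simp add: ckD(1)[OF assms(1)] ckD(1)[OF assms(2)])

lemma ck_diff:
  assumes "x \<in> bcarrier (ck_bimodule G)" "y \<in> bcarrier (ck_bimodule G)"
  shows "x - y \<in> bcarrier (ck_bimodule G)"
proof -
  have "x - y = x + (\<lambda>l. -1 * y l)" by (auto simp: fun_eq_iff)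
  then show ?thesis using ck_add[OF assms(1) ck_scale[OF assms(2), of "-1"]] by (simp only:)
qed

lemma ck_bright: "x \<in> bcarrier (ck_bimodule G) \<Longrightarrow> a \<in> alg (C0 (verts G))
    \<Longrightarrow> (\<lambda>l. x l * a (head G l)) \<in> bcarrier (ck_bimodule G)"
  using ck_bounded_multiple(1)[of x "\<lambda>l. a (head G l)" "anorm (C0 (verts G)) a"] C0_norm_upper[of a "verts G"] by (simp add: mult.commute)

lemma ck_bleft: "x \<in> bcarrier (ck_bimodule G) \<Longrightarrow> a \<in> alg (C0 (verts G))
    \<Longrightarrow> (\<lambda>l. a (tail G l) * x l) \<in> bcarrier (ck_bimodule G)"
  using ck_bounded_multiple(1)[of x "\<lambda>l. a (tail G l)" "anorm (C0 (verts G)) a"] C0_norm_upper[of a "verts G"] by simp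

lemma ck_bdist: "bdist (C0 (verts G)) (ck_bimodule G) x y = bnorm (C0 (verts G)) (ck_bimodule G) (x - y)"
proof -
  have "x + (\<lambda>l. - y l) = x - y" by (auto simp: fun_eq_iff)
  then show ?thesis by (simp add: bdist_def bnorm_def ck_simps Let_def)
qed

lemma ck_complete: "complete_wrt (bdist (C0 (verts G)) (ck_bimodule G)) (bcarrier (ck_bimodule G))"
  unfolding complete_wrt_def
proof (intro allI impI, elim conjE)
  let ?d = "bdist (C0 (verts G)) (ck_bimodule G)" and ?C = "bcarrier (ck_bimodule G)"
  fix \<sigma> assume "range \<sigma> \<subseteq> ?C" and cau: "cauchy_wrt ?d \<sigma>"
  then have mem: "\<sigma> n \<in> ?C" for n by auto
  have sq: "ck_sq G (\<sigma> m - \<sigma> n) v \<le> (?d (\<sigma> m) (\<sigma> n))\<^sup>2" for m n v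
    unfolding ck_bdist by (rule ck_sq_le_bnorm[OF ck_diff[OF mem mem]])
  have dnn: "0 \<le> ?d (\<sigma> m) (\<sigma> n)" for m n
    unfolding ck_bdist by (rule ck_bnorm_nonneg[OF ck_diff[OF mem mem]])
  have up: "cmod (\<sigma> m l - \<sigma> n l) \<le> ?d (\<sigma> m) (\<sigma> n)" for m n l
  proof (cases "l \<in> arcs G")
    case True
    have "(cmod (\<sigma> m l - \<sigma> n l))\<^sup>2 \<le> (?d (\<sigma> m) (\<sigma> n))\<^sup>2"
      using order_trans[OF cmod_le_ck_sq[OF ck_diff[OF mem[of m] mem[of n]] True] sq] by simp
    then show ?thesis using dnn by (rule power2_le_imp_le)
  next
    case False
    then show ?thesis using dnn by (simp add: ckD(1)[OF mem])
  qed
  have "\<exists>c. (\<lambda>n. \<sigma> n l) \<longlonglongrightarrow> c" for l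
    using cauchy_wrt_dominated[OF cau, of "\<lambda>n. \<sigma> n l"] up by (simp add: Cauchy_convergent_iff convergent_def)
  then obtain x where x: "\<And>l. (\<lambda>n. \<sigma> n l) \<longlonglongrightarrow> x l" by metis
  have close: "\<exists>N. \<forall>n\<ge>N. \<forall>v. (x - \<sigma> n) sq_summable_on in_arcs G v \<and> ck_sq G (x - \<sigma> n) v \<le> \<epsilon>\<^sup>2"
    if \<epsilon>: "\<epsilon> > 0" for \<epsilon>
  proof -
    obtain N where N: "\<And>m n. m \<ge> N \<Longrightarrow> n \<ge> N \<Longrightarrow> ?d (\<sigma> m) (\<sigma> n) < \<epsilon>"
      using cau \<epsilon> unfolding cauchy_wrt_def by blast
    have "(x - \<sigma> n) sq_summable_on in_arcs G v \<and> ck_sq G (x - \<sigma> n) v \<le> \<epsilon>\<^sup>2" if n: "n \<ge> N" for n v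
    proof -
      \<comment> \<open>A finite sum may be exchanged with the limit in m. A bound valid for every
        finite set of edges then gives both summability and the bound for the infinite sum.\<close>
      have fin: "(\<Sum>l\<in>F. (cmod ((x - \<sigma> n) l))\<^sup>2) \<le> \<epsilon>\<^sup>2" if F: "finite F" "F \<subseteq> in_arcs G v" for F
      proof (rule LIMSEQ_le_const2)
        show "(\<lambda>m. \<Sum>l\<in>F. (cmod ((\<sigma> m - \<sigma> n) l))\<^sup>2) \<longlonglongrightarrow> (\<Sum>l\<in>F. (cmod ((x - \<sigma> n) l))\<^sup>2)"
          by (auto intro!: tendsto_intros x)
        have "(\<Sum>l\<in>F. (cmod ((\<sigma> m - \<sigma> n) l))\<^sup>2) \<le> \<epsilon>\<^sup>2" if m: "m \<ge> N" for m
        proof -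
          have "(\<Sum>l\<in>F. (cmod ((\<sigma> m - \<sigma> n) l))\<^sup>2) \<le> ck_sq G (\<sigma> m - \<sigma> n) v"
            unfolding ck_sq_def using F by (intro finite_sum_le_infsum ckD(2) ck_diff mem) auto
          also have "\<dots> \<le> (?d (\<sigma> m) (\<sigma> n))\<^sup>2" by (rule sq)
          also have "\<dots> \<le> \<epsilon>\<^sup>2" using N[OF m n] dnn by (intro power_mono) auto
          finally show ?thesis .
        qed
        then show "\<exists>M. \<forall>m\<ge>M. (\<Sum>l\<in>F. (cmod ((\<sigma> m - \<sigma> n) l))\<^sup>2) \<le> \<epsilon>\<^sup>2" by blast
      qed
      have s: "(x - \<sigma> n) sq_summable_on in_arcs G v"
        by (rule nonneg_bdd_above_summable_on) (use fin in \<open>auto intro!: bdd_aboveI2\<close>)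
      show ?thesis using s infsum_le_finite_sums[OF s fin] by (simp add: ck_sq_def)
    qed
    then show ?thesis by blast
  qed
  have xN: "x = (x - \<sigma> n) + \<sigma> n" for n by simp
  have x0: "x l = 0" if "l \<notin> arcs G" for l
    using x[of l] that by (simp add: ckD(1)[OF mem] LIMSEQ_const_iff)
  have s: "x sq_summable_on in_arcs G v" for v
  proof -
    obtain N where "(x - \<sigma> N) sq_summable_on in_arcs G v" using close[of 1] by auto
    then show ?thesis using sq_summable_add(1)[of "x - \<sigma> N" _ "\<sigma> N"] ckD(2)[OF mem] by simp
  qed
  have "vanishes_at_infinity (verts G) (ck_sq G x)"
    unfolding vanishes_at_infinity_def
  proof (intro allI impI)
    fix \<epsilon> :: real assume \<epsilon>: "\<epsilon> > 0"
    \<comment> \<open>The value \<epsilon>/4 fits \<open>ck_sq G x v\<close> <= 2 * \<epsilon>/4 + 2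
      * \<open>ck_sq G (\<sigma> N) v\<close>: if the left side is at least \<epsilon>, the last
      value is at least \<epsilon>/4.\<close>
    then obtain N where N: "\<And>v. (x - \<sigma> N) sq_summable_on in_arcs G v"
        "\<And>v. ck_sq G (x - \<sigma> N) v \<le> (sqrt (\<epsilon>/4))\<^sup>2"
      using close[of "sqrt (\<epsilon>/4)"] by auto
    have "ck_sq G (\<sigma> N) v \<ge> \<epsilon>/4" if "ck_sq G x v \<ge> \<epsilon>" for v
      using sq_summable_add(2)[OF N(1) ckD(2)[OF mem[of N]], of v] N(2)[of v] that \<epsilon>
      by (simp add: ck_sq_def)
    then have "{v \<in> verts G. norm (ck_sq G x v) \<ge> \<epsilon>} \<subseteq> {v \<in> verts G. norm (ck_sq G (\<sigma> N) v) \<ge> \<epsilon>/4}"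
      by (auto simp: ck_sq_nonneg)
    then show "finite {v \<in> verts G. norm (ck_sq G x v) \<ge> \<epsilon>}"
      by (rule finite_subset) (rule vanishes_at_infinityD, use ckD(3)[OF mem] \<epsilon> in auto)
  qed
  then have xmem: "x \<in> ?C" using s x0 by (simp add: ck_iff)
  have "(\<lambda>n. ?d (\<sigma> n) x) \<longlonglongrightarrow> 0"
  proof (rule LIMSEQ_I)
    fix r :: real assume r: "r > 0"
    then obtain N where N: "\<And>n v. n \<ge> N \<Longrightarrow> ck_sq G (x - \<sigma> n) v \<le> (r/2)\<^sup>2"
      using close[of "r/2"] by auto
    have "?d (\<sigma> n) x \<le> r/2" if "n \<ge> N" for n
      unfolding ck_bdist
    proof (rule ck_bnorm_le[OF ck_diff[OF mem xmem]])
      show "ck_sq G (\<sigma> n - x) v \<le> (r/2)\<^sup>2" for v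
        using N[OF that] by (simp add: ck_sq_def norm_minus_commute)
    qed (use r in simp)
    then have "norm (?d (\<sigma> n) x - 0) < r" if "n \<ge> N" for n
      using ck_bnorm_nonneg[OF ck_diff[OF mem xmem]] that r by (fastforce simp: ck_bdist)
    then show "\<exists>N. \<forall>n\<ge>N. norm (?d (\<sigma> n) x - 0) < r" by blast
  qed
  with xmem show "\<exists>x\<in>?C. (\<lambda>n. ?d (\<sigma> n) x) \<longlonglongrightarrow> 0" by blast
qed

text \<open>The pointwise square root is a witness. It vanishes at infinity because sqrt t >=
  \<epsilon> is the same as t >= \<epsilon>^2.\<close>

lemma ck_inner_positive:
  assumes "x \<in> bcarrier (ck_bimodule G)"
  shows "apositive (C0 (verts G)) (binner (ck_bimodule G) x x)"
  unfolding apositive_def ck_inner_self[OF assms]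
proof
  let ?b = "\<lambda>v. complex_of_real (sqrt (ck_sq G x v))"
  show "(\<lambda>v. complex_of_real (ck_sq G x v)) = astar (C0 (verts G)) ?b * ?b"
    by (simp add: C0_simps fun_eq_iff ck_sq_nonneg flip: of_real_mult)
  have "\<epsilon> \<le> sqrt t \<longleftrightarrow> \<epsilon>\<^sup>2 \<le> t" if "\<epsilon> > 0" "t \<ge> 0" for \<epsilon> t :: real
    using that real_sqrt_le_iff[of "\<epsilon>\<^sup>2" t] by simp
  then show "?b \<in> alg (C0 (verts G))"
    using ckD(3)[OF assms] by (simp add: C0_iff ck_sq_zero vanishes_at_infinity_def ck_sq_nonneg)
qed

lemma ck_inner_definite:
  assumes "x \<in> bcarrier (ck_bimodule G)" "binner (ck_bimodule G) x x = 0"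
  shows "x = 0"
proof
  fix l
  show "x l = 0 l"
  proof (cases "l \<in> arcs G")
    case True
    have "ck_sq G x (head G l) = 0"
      using fun_cong[OF assms(2)] by (simp add: ck_inner_self[OF assms(1)])
    then show ?thesis using cmod_le_ck_sq[OF assms(1) True] by simp
  qed (simp add: ckD(1)[OF assms(1)])
qed

lemma ck_inner_add:
  assumes "x \<in> bcarrier (ck_bimodule G)" "y \<in> bcarrier (ck_bimodule G)" "z \<in> bcarrier (ck_bimodule G)"
  shows "binner (ck_bimodule G) x (y + z) = binner (ck_bimodule G) x y + binner (ck_bimodule G) x z"
  unfolding ck_simps
  by (rule ext) (simp add: distrib_left infsum_add ck_inner_summable assms)

lemma ck_inner_right:
  "binner (ck_bimodule G) x (\<lambda>l. y l * a (head G l)) = binner (ck_bimodule G) x y * a"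
proof
  fix v
  have "(\<Sum>\<^sub>\<infinity>l\<in>in_arcs G v. cnj (x l) * (y l * a (head G l))) = (\<Sum>\<^sub>\<infinity>l\<in>in_arcs G v. cnj (x l) * y l * a v)"
    by (rule infsum_cong) (simp add: in_arcs_def)
  then show "binner (ck_bimodule G) x (\<lambda>l. y l * a (head G l)) v = (binner (ck_bimodule G) x y * a) v"
    by (simp add: ck_simps infsum_cmult_left')
qed

lemma ck_inner_star: "astar (C0 V) (binner (ck_bimodule G) x y) = binner (ck_bimodule G) y x"
  by (simp add: C0_simps ck_simps mult.commute flip: infsum_cnj)

theorem hilbert_bimodule_ck: "hilbert_bimodule (C0 (verts G)) (ck_bimodule G)"
proof (intro hilbert_bimodule.intro cstar_algebra_C0 hilbert_bimodule_axioms.intro)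
  show "\<And>x c y. binner (ck_bimodule G) x (bscale (ck_bimodule G) c y) =
      ascale (C0 (verts G)) c (binner (ck_bimodule G) x y)"
    by (simp add: ck_simps C0_simps mult.left_commute infsum_cmult_right')
  show "\<And>a x y. binner (ck_bimodule G) (bleft (ck_bimodule G) a x) y =
      binner (ck_bimodule G) x (bleft (ck_bimodule G) (astar (C0 (verts G)) a) y)"
    by (simp add: ck_simps C0_simps mult_ac)
  show "\<And>a x. \<lbrakk>a \<in> alg (C0 (verts G)); x \<in> bcarrier (ck_bimodule G)\<rbrakk>
      \<Longrightarrow> bleft (ck_bimodule G) a x \<in> bcarrier (ck_bimodule G)"
    by (simp add: ck_simps(5) ck_bleft)
qed (auto simp: ck_simps(1-5) C0_simps ck_add ck_zero ck_scale ck_bright ck_inner_closed ck_inner_add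
    ck_inner_right[unfolded ck_simps] ck_inner_right ck_inner_positive ck_complete ck_inner_star[unfolded C0_simps]
    fun_eq_iff algebra_simps dest: ck_inner_definite)

theorem normed_bimodule_ck: "normed_bimodule (C0 (verts G)) (ck_bimodule G)"
proof (intro normed_bimodule.intro hilbert_bimodule_ck normed_bimodule_axioms.intro)
  let ?n = "bnorm (C0 (verts G)) (ck_bimodule G)"
  show "badd (ck_bimodule G) = (+)" by (simp add: ck_simps)
  fix x y assume x: "x \<in> bcarrier (ck_bimodule G)" and y: "y \<in> bcarrier (ck_bimodule G)"
  show "anorm (C0 (verts G)) (binner (ck_bimodule G) x y) \<le> ?n x * ?n y"
  proof (rule C0_norm_least)
    fix v
    have "sqrt (ck_sq G z v) \<le> ?n z" if "z \<in> bcarrier (ck_bimodule G)" for z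
      using ck_sq_le_bnorm[OF that] ck_bnorm_nonneg[OF that] by (intro real_le_lsqrt) (auto simp: ck_sq_nonneg)
    then show "cmod (binner (ck_bimodule G) x y v) \<le> ?n x * ?n y"
      by (intro order_trans[OF ck_inner_bound[OF x y]] mult_mono)
        (auto simp: x y ck_sq_nonneg ck_bnorm_nonneg)
  qed
next
  let ?n = "bnorm (C0 (verts G)) (ck_bimodule G)"
  fix a x assume a: "a \<in> alg (C0 (verts G))" and x: "x \<in> bcarrier (ck_bimodule G)"
  have "ck_sq G (\<lambda>l. a (tail G l) * x l) v \<le> (anorm (C0 (verts G)) a * ?n x)\<^sup>2" for v
    unfolding power_mult_distrib
    using ck_bounded_multiple(2)[OF x, of "\<lambda>l. a (tail G l)" "anorm (C0 (verts G)) a" v]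
      C0_norm_upper[OF a] mult_left_mono[OF ck_sq_le_bnorm[OF x, of v], of "(anorm (C0 (verts G)) a)\<^sup>2"]
    by (meson order_trans zero_le_power2)
  then show "?n (bleft (ck_bimodule G) a x) \<le> anorm (C0 (verts G)) a * ?n x"
    unfolding ck_simps
    by (intro ck_bnorm_le ck_bleft x a mult_nonneg_nonneg C0_norm_nonneg ck_bnorm_nonneg)
qed

end

section \<open>Point masses\<close>

context wf_digraph
begin

lemma ck_finite_support:
  assumes "finite {l. x l \<noteq> 0}" "{l. x l \<noteq> 0} \<subseteq> arcs G"
  shows "x \<in> bcarrier (ck_bimodule G)"
  unfolding ck_iff
proof (intro conjI allI impI)
  show "x sq_summable_on in_arcs G v" for v
    by (rule finite_nonzero_values_imp_summable_on) (use assms in \<open>auto intro: finite_subset[OF _ assms(1)]\<close>)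
  have "{v \<in> verts G. norm (ck_sq G x v) \<ge> \<epsilon>} \<subseteq> head G ` {l. x l \<noteq> 0}" if "\<epsilon> > 0" for \<epsilon>
  proof (rule subsetI, rule ccontr)
    fix v assume v: "v \<in> {v \<in> verts G. norm (ck_sq G x v) \<ge> \<epsilon>}" and "v \<notin> head G ` {l. x l \<noteq> 0}"
    then have "x l = 0" if "l \<in> in_arcs G v" for l
      using that by (auto simp: in_arcs_def)
    then have "ck_sq G x v = 0" unfolding ck_sq_def by (intro infsum_0) simp
    then show False using v \<open>\<epsilon> > 0\<close> by simp
  qed
  then show "vanishes_at_infinity (verts G) (ck_sq G x)"
    unfolding vanishes_at_infinity_def using assms(1) by (meson finite_imageI finite_subset)
qed (use assms(2) in auto)

lemma point_mass_mem: "l \<in> arcs G \<Longrightarrow> point_mass l \<in> bcarrier (ck_bimodule G)"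
  by (rule ck_finite_support) (auto simp: point_mass_def)

lemma binner_point_mass:
  assumes "l \<in> arcs G"
  shows "binner (ck_bimodule G) (point_mass l) x (head G l) = x l"
proof -
  have "(\<Sum>\<^sub>\<infinity>k\<in>in_arcs G (head G l). cnj (point_mass l k) * x k) = (\<Sum>\<^sub>\<infinity>k\<in>{l}. cnj (point_mass l k) * x k)"
    by (rule infsum_cong_neutral) (use assms in \<open>auto simp: point_mass_def in_arcs_def\<close>)
  then show ?thesis by (simp add: ck_simps point_mass_def)
qed

text \<open>The error has to be small at all vertices at once. At the finitely many vertices where
  <z, z> is large, a finite set of incoming edges carries almost the whole sum; at the others z may
  be cut to 0 entirely, since <z, z> is small there.\<close>

lemma finite_approximation:
  assumes z: "z \<in> bcarrier (ck_bimodule G)" and \<epsilon>: "\<epsilon> > 0"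
  shows "\<exists>N. finite N \<and> N \<subseteq> arcs G \<and>
    bnorm (C0 (verts G)) (ck_bimodule G) ((\<lambda>l. if l \<in> N then z l else 0) - z) < \<epsilon>"
proof -
  \<comment> \<open>The threshold is squared because the norm is a square root of <z, z>, and
    \<epsilon> is halved because the sums yield a non-strict bound.\<close>
  let ?S = "{v \<in> verts G. norm (ck_sq G z v) \<ge> (\<epsilon>/2)\<^sup>2}"
  have finS: "finite ?S" using ckD(3)[OF z] by (rule vanishes_at_infinityD) (use \<epsilon> in simp)
  have "\<exists>F. finite F \<and> F \<subseteq> in_arcs G v \<and> dist (\<Sum>l\<in>F. (cmod (z l))\<^sup>2) (ck_sq G z v) \<le> (\<epsilon>/2)\<^sup>2" for v
    unfolding ck_sq_def by (rule infsum_finite_approximation[OF ckD(2)[OF z]]) (use \<epsilon> in simp)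
  then obtain F where F: "\<And>v. finite (F v)" "\<And>v. F v \<subseteq> in_arcs G v"
      "\<And>v. dist (\<Sum>l\<in>F v. (cmod (z l))\<^sup>2) (ck_sq G z v) \<le> (\<epsilon>/2)\<^sup>2"
    by metis
  define N where "N = (\<Union>v\<in>?S. F v)"
  let ?z = "\<lambda>l. if l \<in> N then z l else 0"
  have N: "finite N" "N \<subseteq> arcs G"
    using finS F(1,2) by (auto simp: N_def in_arcs_def)
  have mem: "?z - z \<in> bcarrier (ck_bimodule G)"
    using N by (intro ck_diff z ck_finite_support) (auto intro: finite_subset[OF _ N(1)] split: if_splits)
  have "ck_sq G (?z - z) v \<le> (\<epsilon>/2)\<^sup>2" for v
    unfolding ck_sq_def
  proof (rule infsum_le_finite_sums[OF ckD(2)[OF mem]])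
    fix K assume K: "finite K" "K \<subseteq> in_arcs G v"
    have eq: "(\<Sum>l\<in>K. (cmod ((?z - z) l))\<^sup>2) = (\<Sum>l\<in>K - N. (cmod (z l))\<^sup>2)"
      using K(1) by (intro sum.mono_neutral_cong_right) auto
    show "(\<Sum>l\<in>K. (cmod ((?z - z) l))\<^sup>2) \<le> (\<epsilon>/2)\<^sup>2"
    proof (cases "v \<in> ?S")
      case True
      then have "F v \<subseteq> N" by (auto simp: N_def)
      \<comment> \<open>The edges of K outside N are disjoint from F v, and both sets lie over v.
        What they carry is thus at most the total minus the part carried by F v.\<close>
      then have "(\<Sum>l\<in>K - N. (cmod (z l))\<^sup>2) + (\<Sum>l\<in>F v. (cmod (z l))\<^sup>2) = (\<Sum>l\<in>(K - N) \<union> F v. (cmod (z l))\<^sup>2)"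
        using K F(1) by (intro sum.union_disjoint[symmetric]) auto
      also have "\<dots> \<le> ck_sq G z v"
        unfolding ck_sq_def using K F(1,2) by (intro finite_sum_le_infsum ckD(2)[OF z]) auto
      finally show ?thesis using F(3)[of v] unfolding eq dist_real_def by linarith
    next
      case False
      have "(\<Sum>l\<in>K - N. (cmod (z l))\<^sup>2) \<le> ck_sq G z v"
        unfolding ck_sq_def using K by (intro finite_sum_le_infsum ckD(2)[OF z]) auto
      also have "\<dots> \<le> (\<epsilon>/2)\<^sup>2"
        using False ck_sq_zero[of v z] ck_sq_nonneg[of G z v] by (cases "v \<in> verts G") auto
      finally show ?thesis by (simp only: eq)
    qed
  qed
  then have "bnorm (C0 (verts G)) (ck_bimodule G) (?z - z) \<le> \<epsilon>/2"
    using \<epsilon> by (intro ck_bnorm_le mem) auto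
  then show ?thesis using N \<epsilon> by (intro exI[of _ N]) auto
qed

end

section \<open>The product along a factorisation of edges\<close>

text \<open>A single isomorphism \<phi> p q in isolation, without the semigroup. The vertex set is a
  parameter of its own so that the three bimodules have literally the same coefficient
  algebra.\<close>

locale edge_factorisation =
  G: wf_digraph G + H: wf_digraph H + K: wf_digraph K
  for G :: "('v, 'e) pre_digraph" and H :: "('v, 'f) pre_digraph" and K :: "('v, 'g) pre_digraph" +
  fixes f :: "'e \<times> 'f \<Rightarrow> 'g" and V :: "'v set"
  assumes verts_G: "verts G = V" and verts_H: "verts H = V" and verts_K: "verts K = V"
    and iso: "graph_iso_over_verts (fibre_product G H) K f"
begin

definition edge_product :: "('e \<Rightarrow> complex) \<Rightarrow> ('f \<Rightarrow> complex) \<Rightarrow> 'g \<Rightarrow> complex" where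
  "edge_product x y n = (if n \<in> arcs K
     then case the_inv_into (arcs (fibre_product G H)) f n of (l, k) \<Rightarrow> x l * y k else 0)"

lemma pairs_iff: "(l, k) \<in> arcs (fibre_product G H) \<longleftrightarrow> l \<in> arcs G \<and> k \<in> arcs H \<and> head G l = tail H k"
  by (simp add: fibre_product_def)

lemma bij_f: "bij_betw f (arcs (fibre_product G H)) (arcs K)"
  using iso by (simp add: graph_iso_over_verts_def)

lemma edge_cases:
  assumes "n \<in> arcs K"
  obtains l k where "n = f (l, k)" "(l, k) \<in> arcs (fibre_product G H)"
  using assms bij_f unfolding bij_betw_def by (metis imageE surj_pair)

lemma f_closed: "(l, k) \<in> arcs (fibre_product G H) \<Longrightarrow> f (l, k) \<in> arcs K"
  using bij_f by (auto simp: bij_betw_def)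

lemma f_eq_iff: "\<lbrakk>(l, k) \<in> arcs (fibre_product G H); (l', k') \<in> arcs (fibre_product G H)\<rbrakk>
    \<Longrightarrow> f (l, k) = f (l', k') \<longleftrightarrow> l = l' \<and> k = k'"
  using bij_f by (auto simp: bij_betw_def inj_on_def)

lemma tail_f: "(l, k) \<in> arcs (fibre_product G H) \<Longrightarrow> tail K (f (l, k)) = tail G l"
  and head_f: "(l, k) \<in> arcs (fibre_product G H) \<Longrightarrow> head K (f (l, k)) = head H k"
  using iso by (auto simp: graph_iso_over_verts_def fibre_product_def)

lemma edge_product_f:
  "(l, k) \<in> arcs (fibre_product G H) \<Longrightarrow> edge_product x y (f (l, k)) = x l * y k"
  using the_inv_into_f_f[OF bij_betw_imp_inj_on[OF bij_f]] by (simp add: edge_product_def f_closed)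

lemma edge_product_outside: "n \<notin> arcs K \<Longrightarrow> edge_product x y n = 0"
  by (simp add: edge_product_def)

text \<open>Every edge of K is some f (l, k), so the two premises fix z everywhere. The rule for
  point masses, compatibility with the actions, associativity and uniqueness are all reduced to
  coefficients by this lemma.\<close>

lemma edge_product_eqI:
  assumes "\<And>n. n \<notin> arcs K \<Longrightarrow> z n = 0"
    and "\<And>l k. (l, k) \<in> arcs (fibre_product G H) \<Longrightarrow> z (f (l, k)) = x l * y k"
  shows "edge_product x y = z"
proof
  fix n
  show "edge_product x y n = z n"
    using assms edge_cases[of n] by (cases "n \<in> arcs K") (metis edge_product_f, simp add: edge_product_outside)
qed

lemma edge_product_point_mass:
  assumes "l \<in> arcs G" "k \<in> arcs H"
  shows "edge_product (point_mass l) (point_mass k) =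
    (if (l, k) \<in> arcs (fibre_product G H) then point_mass (f (l, k)) else 0)"
  by (rule edge_product_eqI) (auto simp: point_mass_def f_closed f_eq_iff)

text \<open>The range of lk is the range of k, so edges into v are sorted by their second factor k,
  and l runs over the edges into the source of k. In this order the inner sum is an inner product of
  G, evaluated at \<open>tail H k\<close>.\<close>

lemma bij_in_arcs:
  "bij_betw (\<lambda>(k, l). f (l, k)) (SIGMA k:in_arcs H v. in_arcs G (tail H k)) (in_arcs K v)"
proof (rule bij_betw_imageI)
  let ?S = "SIGMA k:in_arcs H v. in_arcs G (tail H k)"
  have S: "(k, l) \<in> ?S \<longleftrightarrow> (l, k) \<in> arcs (fibre_product G H) \<and> head H k = v" for k l
    by (auto simp: in_arcs_def pairs_iff)
  show "inj_on (\<lambda>(k, l). f (l, k)) ?S"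
  proof (rule inj_onI)
    fix p q assume p: "p \<in> ?S" and q: "q \<in> ?S"
      and eq: "(case p of (k, l) \<Rightarrow> f (l, k)) = (case q of (k, l) \<Rightarrow> f (l, k))"
    obtain k l k' l' where pq: "p = (k, l)" "q = (k', l')" by fastforce
    have "(l, k) \<in> arcs (fibre_product G H)" "(l', k') \<in> arcs (fibre_product G H)"
      using p q S by (auto simp only: pq)
    then show "p = q" using eq f_eq_iff by (simp add: pq)
  qed
  show "(\<lambda>(k, l). f (l, k)) ` ?S = in_arcs K v"
  proof (intro equalityI subsetI)
    fix n assume "n \<in> (\<lambda>(k, l). f (l, k)) ` ?S"
    then obtain k l where "n = f (l, k)" "(k, l) \<in> ?S" by (auto simp del: mem_Sigma_iff)
    then show "n \<in> in_arcs K v" using S f_closed head_f by (simp add: in_arcs_def del: mem_Sigma_iff)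
  next
    fix n assume n: "n \<in> in_arcs K v"
    then obtain l k where lk: "n = f (l, k)" "(l, k) \<in> arcs (fibre_product G H)"
      using edge_cases by (auto simp: in_arcs_def)
    then have "(k, l) \<in> ?S" using n S head_f by (simp add: in_arcs_def del: mem_Sigma_iff)
    then show "n \<in> (\<lambda>(k, l). f (l, k)) ` ?S" using lk(1) by force
  qed
qed

text \<open>Reindexing by the factorisation, followed by Fubini. Fubini requires summability over
  all edges into v, so square summability of the product is established beforehand by other
  means.\<close>

lemma infsum_in_arcs:
  fixes g :: "'g \<Rightarrow> 'b::banach"
  assumes "g summable_on in_arcs K v"
  shows "(\<Sum>\<^sub>\<infinity>n\<in>in_arcs K v. g n) = (\<Sum>\<^sub>\<infinity>k\<in>in_arcs H v. \<Sum>\<^sub>\<infinity>l\<in>in_arcs G (tail H k). g (f (l, k)))"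
proof -
  let ?S = "SIGMA k:in_arcs H v. in_arcs G (tail H k)"
  have s: "(\<lambda>p. g (case p of (k, l) \<Rightarrow> f (l, k))) summable_on ?S"
    using summable_on_reindex_bij_betw[OF bij_in_arcs, of g v] assms by simp
  have "(\<Sum>\<^sub>\<infinity>n\<in>in_arcs K v. g n) = (\<Sum>\<^sub>\<infinity>p\<in>?S. g (case p of (k, l) \<Rightarrow> f (l, k)))"
    using infsum_reindex_bij_betw[OF bij_in_arcs, of g v] by simp
  also have "\<dots> = (\<Sum>\<^sub>\<infinity>k\<in>in_arcs H v. \<Sum>\<^sub>\<infinity>l\<in>in_arcs G (tail H k). g (f (l, k)))"
    using infsum_Sigma_banach[OF s] by simp
  finally show ?thesis .
qed

lemma pair_of_in_arcs: "k \<in> in_arcs H v \<Longrightarrow> l \<in> in_arcs G (tail H k) \<Longrightarrow> (l, k) \<in> arcs (fibre_product G H)"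
  by (simp add: in_arcs_def pairs_iff)

section \<open>Square summability and norm estimates for the product\<close>

context
  fixes x y
  assumes x: "x \<in> bcarrier (ck_bimodule G)" and y: "y \<in> bcarrier (ck_bimodule H)"
begin

text \<open>The weight \<open>ck_sq G x (tail H k)\<close> is the sum over the first factor l; it is
  bounded by ||x||^2 uniformly in k.\<close>

lemma edge_product_weight_summable:
  "(\<lambda>k. (cmod (y k))\<^sup>2 * ck_sq G x (tail H k)) summable_on in_arcs H v"
proof (rule summable_on_comparison_test)
  show "(\<lambda>k. (cmod (y k))\<^sup>2 * (bnorm (C0 V) (ck_bimodule G) x)\<^sup>2) summable_on in_arcs H v"
    by (intro summable_on_cmult_left H.ckD(2) y)
  show "(cmod (y k))\<^sup>2 * ck_sq G x (tail H k) \<le> (cmod (y k))\<^sup>2 * (bnorm (C0 V) (ck_bimodule G) x)\<^sup>2" for k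
    using G.ck_sq_le_bnorm[OF x] by (intro mult_left_mono) (auto simp: verts_G)
qed (simp add: ck_sq_nonneg)

text \<open>Tonelli: the terms are nonnegative, the sum over l is known exactly for each k, and
  these sums are summable over k.\<close>

lemma edge_product_sq_summable: "edge_product x y sq_summable_on in_arcs K v"
proof -
  let ?h = "\<lambda>n. (cmod (edge_product x y n))\<^sup>2"
  have "(\<lambda>p. ?h (case p of (k, l) \<Rightarrow> f (l, k))) summable_on (SIGMA k:in_arcs H v. in_arcs G (tail H k))"
  proof (rule summable_on_SigmaI[OF _ edge_product_weight_summable])
    fix k assume k: "k \<in> in_arcs H v"
    have "((\<lambda>l. (cmod (y k))\<^sup>2 * (cmod (x l))\<^sup>2) has_sum (cmod (y k))\<^sup>2 * ck_sq G x (tail H k)) (in_arcs G (tail H k))"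
      unfolding ck_sq_def by (intro has_sum_cmult_right has_sum_infsum G.ckD(2) x)
    then show "((\<lambda>l. ?h (case (k, l) of (k, l) \<Rightarrow> f (l, k))) has_sum (cmod (y k))\<^sup>2 * ck_sq G x (tail H k))
        (in_arcs G (tail H k))"
      by (rule has_sum_cong[THEN iffD1, rotated])
        (simp add: edge_product_f pair_of_in_arcs[OF k] norm_mult power_mult_distrib)
  qed simp
  then show ?thesis using summable_on_reindex_bij_betw[OF bij_in_arcs, of ?h v] by simp
qed

lemma ck_sq_edge_product:
  "ck_sq K (edge_product x y) v = (\<Sum>\<^sub>\<infinity>k\<in>in_arcs H v. (cmod (y k))\<^sup>2 * ck_sq G x (tail H k))"
  unfolding ck_sq_def[of K] infsum_in_arcs[OF edge_product_sq_summable]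
proof (rule infsum_cong)
  fix k assume k: "k \<in> in_arcs H v"
  have "(\<Sum>\<^sub>\<infinity>l\<in>in_arcs G (tail H k). (cmod (edge_product x y (f (l, k))))\<^sup>2) =
      (\<Sum>\<^sub>\<infinity>l\<in>in_arcs G (tail H k). (cmod (y k))\<^sup>2 * (cmod (x l))\<^sup>2)"
    by (rule infsum_cong) (simp add: edge_product_f pair_of_in_arcs[OF k] norm_mult power_mult_distrib)
  then show "(\<Sum>\<^sub>\<infinity>l\<in>in_arcs G (tail H k). (cmod (edge_product x y (f (l, k))))\<^sup>2) =
      (cmod (y k))\<^sup>2 * ck_sq G x (tail H k)"
    by (simp add: ck_sq_def infsum_cmult_right')
qed

text \<open>Bounding the weights by ||x||^2 gives <xy, xy> <= ||x||^2 <y, y> at each vertex, so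
  vanishing at infinity is inherited from y.\<close>

lemma edge_product_closed: "edge_product x y \<in> bcarrier (ck_bimodule K)"
  unfolding K.ck_iff
proof (intro conjI allI impI edge_product_outside edge_product_sq_summable)
  have "ck_sq K (edge_product x y) v \<le> (bnorm (C0 V) (ck_bimodule G) x)\<^sup>2 * ck_sq H y v" for v
    unfolding ck_sq_edge_product ck_sq_def[of H] infsum_cmult_right'[symmetric]
  proof (rule infsum_mono[OF edge_product_weight_summable])
    show "(\<lambda>k. (bnorm (C0 V) (ck_bimodule G) x)\<^sup>2 * (cmod (y k))\<^sup>2) summable_on in_arcs H v"
      by (intro summable_on_cmult_right H.ckD(2) y)
    show "(cmod (y k))\<^sup>2 * ck_sq G x (tail H k) \<le> (bnorm (C0 V) (ck_bimodule G) x)\<^sup>2 * (cmod (y k))\<^sup>2" for k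
      using mult_left_mono[OF G.ck_sq_le_bnorm[OF x, of "tail H k"], of "(cmod (y k))\<^sup>2"]
      by (simp add: verts_G mult.commute)
  qed
  then have "norm (ck_sq K (edge_product x y) v) \<le>
      (bnorm (C0 V) (ck_bimodule G) x)\<^sup>2 * (norm (ck_sq H y v) + norm (ck_sq H y v))" for v
    using mult_nonneg_nonneg[OF zero_le_power2[of "bnorm (C0 V) (ck_bimodule G) x"] ck_sq_nonneg[of H y v]]
    by (smt (verit) ck_sq_nonneg distrib_left real_norm_def)
  then show "vanishes_at_infinity (verts K) (ck_sq K (edge_product x y))"
    unfolding verts_K
    by (rule vanishes_at_infinity_dominated[OF H.ckD(3)[OF y, unfolded verts_H] H.ckD(3)[OF y, unfolded verts_H]])
qed

end

lemma edge_product_inner: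
  assumes "x \<in> bcarrier (ck_bimodule G)" "y \<in> bcarrier (ck_bimodule H)"
    and "x' \<in> bcarrier (ck_bimodule G)" "y' \<in> bcarrier (ck_bimodule H)"
  shows "binner (ck_bimodule K) (edge_product x y) (edge_product x' y') =
    binner (ck_bimodule H) y (bleft (ck_bimodule H) (binner (ck_bimodule G) x x') y')"
proof
  fix v
  have "binner (ck_bimodule K) (edge_product x y) (edge_product x' y') v =
      (\<Sum>\<^sub>\<infinity>k\<in>in_arcs H v. \<Sum>\<^sub>\<infinity>l\<in>in_arcs G (tail H k).
        cnj (edge_product x y (f (l, k))) * edge_product x' y' (f (l, k)))"
    unfolding ck_simps
    by (rule infsum_in_arcs[OF K.ck_inner_summable]) (auto intro!: edge_product_closed assms)
  also have "\<dots> = (\<Sum>\<^sub>\<infinity>k\<in>in_arcs H v.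
      \<Sum>\<^sub>\<infinity>l\<in>in_arcs G (tail H k). (cnj (x l) * x' l) * (cnj (y k) * y' k))"
    by (intro infsum_cong) (simp add: edge_product_f pair_of_in_arcs mult_ac)
  also have "\<dots> = (\<Sum>\<^sub>\<infinity>k\<in>in_arcs H v.
      cnj (y k) * ((\<Sum>\<^sub>\<infinity>l\<in>in_arcs G (tail H k). cnj (x l) * x' l) * y' k))"
    unfolding infsum_cmult_left' by (intro infsum_cong) (simp add: mult_ac)
  finally show "binner (ck_bimodule K) (edge_product x y) (edge_product x' y') v =
    binner (ck_bimodule H) y (bleft (ck_bimodule H) (binner (ck_bimodule G) x x') y') v"
    by (simp add: ck_simps)
qed

lemma hilbert_G: "hilbert_bimodule (C0 V) (ck_bimodule G)"
  using G.hilbert_bimodule_ck by (simp add: verts_G)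

lemma hilbert_H: "hilbert_bimodule (C0 V) (ck_bimodule H)"
  using H.hilbert_bimodule_ck by (simp add: verts_H)

lemma normed_K: "normed_bimodule (C0 V) (ck_bimodule K)"
  using K.normed_bimodule_ck by (simp add: verts_K)

text \<open>The actions pass through the product because lk has the source of l and the range of
  k.\<close>

sublocale prod: inner_tensor_map "C0 V" "ck_bimodule G" "ck_bimodule H" "ck_bimodule K" edge_product
proof (intro inner_tensor_map.intro inner_tensor_map_axioms.intro hilbert_G hilbert_H normed_K
    edge_product_closed edge_product_inner)
  show "edge_product (bleft (ck_bimodule G) a x) y = bleft (ck_bimodule K) a (edge_product x y)" for a x y
    by (rule edge_product_eqI) (auto simp: ck_simps edge_product_outside edge_product_f tail_f)
  show "edge_product x (bright (ck_bimodule H) y a) = bright (ck_bimodule K) (edge_product x y) a" for a x y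
    by (rule edge_product_eqI) (auto simp: ck_simps edge_product_outside edge_product_f head_f)
qed

text \<open>
  Finite linear combinations of point masses are dense, and every edge of the composite
  graph factorises, so its point mass is a product of two point masses.
\<close>

sublocale prod: tensor_realisation "C0 V" "ck_bimodule G" "ck_bimodule H" "ck_bimodule K" edge_product
proof
  fix z and \<epsilon> :: real assume z: "z \<in> bcarrier (ck_bimodule K)" and "\<epsilon> > 0"
  then obtain N where N: "finite N" "N \<subseteq> arcs K"
      "bnorm (C0 V) (ck_bimodule K) ((\<lambda>n. if n \<in> N then z n else 0) - z) < \<epsilon>"
    using K.finite_approximation[OF z \<open>\<epsilon> > 0\<close>] unfolding verts_K by blast
  have "\<exists>l k. n = f (l, k) \<and> (l, k) \<in> arcs (fibre_product G H)" if "n \<in> N" for n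
    using N(2) that edge_cases by blast
  then obtain a b where ab: "\<And>n. n \<in> N \<Longrightarrow> n = f (a n, b n)"
      "\<And>n. n \<in> N \<Longrightarrow> (a n, b n) \<in> arcs (fibre_product G H)"
    by metis
  then have arc: "a n \<in> arcs G" "b n \<in> arcs H" if "n \<in> N" for n
    using that by (auto simp: pairs_iff)
  \<comment> \<open>The n-th term carries the coefficient z n on the pair of point masses of the
    factors of n, so \<open>ext\<close> sends it to z n times the point mass at n.\<close>
  define t where "t n = Poly_Mapping.single (point_mass (a n), point_mass (b n)) (z n)" for n
  have t: "t n \<in> free_carrier (ck_bimodule G) (ck_bimodule H)" if "n \<in> N" for n
    unfolding t_def using arc[OF that]
    by (intro free_carrier_single G.point_mass_mem H.point_mass_mem)
  have "prod.ext (sum t N) = (\<Sum>n\<in>N. prod.ext (t n))"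
    by (rule prod.ext_sum) (rule t)
  also have "\<dots> = (\<Sum>n\<in>N. (\<lambda>m. z n * point_mass n m))"
  proof (rule sum.cong[OF refl])
    fix n assume n: "n \<in> N"
    show "prod.ext (t n) = (\<lambda>m. z n * point_mass n m)"
      using prod.ext_single[OF G.point_mass_mem[OF arc(1)[OF n]] H.point_mass_mem[OF arc(2)[OF n]], of "z n"]
        edge_product_point_mass[OF arc[OF n]] ab(2)[OF n] ab(1)[OF n, symmetric]
      by (simp add: t_def ck_simps)
  qed
  also have "\<dots> = (\<lambda>n. if n \<in> N then z n else 0)"
  proof
    fix m
    have "(\<Sum>n\<in>N. (\<lambda>m. z n * point_mass n m)) m = (\<Sum>n\<in>N. z n * point_mass n m)"
      using N(1) by (induction N rule: finite_induct) auto
    also have "\<dots> = (if m \<in> N then z m else 0)"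
      using N(1) by (simp add: point_mass_def if_distrib cong: if_cong)
    finally show "(\<Sum>n\<in>N. (\<lambda>m. z n * point_mass n m)) m = (if m \<in> N then z m else 0)" .
  qed
  finally show "\<exists>g\<in>free_carrier (ck_bimodule G) (ck_bimodule H).
      bnorm (C0 V) (ck_bimodule K) (prod.ext g - z) < \<epsilon>"
    using N(3) free_carrier_sum[of N t, OF t] by (intro bexI[of _ "sum t N"]) simp_all
qed

text \<open>
  The coefficients of an element are its inner products with point masses, and an isomorphism
  preserves inner products.
\<close>

lemma tensor_image_eq:
  assumes U: "bimodule_iso (C0 V) (tensor (C0 V) (ck_bimodule G) (ck_bimodule H)) (ck_bimodule K) U"
    and pm: "\<And>l k. (l, k) \<in> arcs (fibre_product G H) \<Longrightarrow>
      U (elem_tensor (C0 V) (ck_bimodule G) (ck_bimodule H) (point_mass l) (point_mass k)) = point_mass (f (l, k))"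
    and x: "x \<in> bcarrier (ck_bimodule G)" and y: "y \<in> bcarrier (ck_bimodule H)"
  shows "U (elem_tensor (C0 V) (ck_bimodule G) (ck_bimodule H) x y) = edge_product x y"
proof (rule edge_product_eqI[symmetric])
  let ?e = "elem_tensor (C0 V) (ck_bimodule G) (ck_bimodule H)"
  have "U (?e x y) \<in> bcarrier (ck_bimodule K)"
    using U prod.elem_tensor_mem[OF x y] by (auto simp: bimodule_iso_def bij_betw_def)
  then show "U (?e x y) n = 0" if "n \<notin> arcs K" for n
    using that by (rule K.ckD(1))
  fix l k assume lk: "(l, k) \<in> arcs (fibre_product G H)"
  then have mem: "point_mass l \<in> bcarrier (ck_bimodule G)" "point_mass k \<in> bcarrier (ck_bimodule H)"
    by (auto simp: pairs_iff G.point_mass_mem H.point_mass_mem)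
  have "binner (ck_bimodule K) (point_mass (f (l, k))) (U (?e x y)) =
      binner (ck_bimodule K) (U (?e (point_mass l) (point_mass k))) (U (?e x y))"
    by (simp add: pm[OF lk])
  also have "\<dots> = binner (tensor (C0 V) (ck_bimodule G) (ck_bimodule H)) (?e (point_mass l) (point_mass k)) (?e x y)"
    using U prod.elem_tensor_mem[OF x y] prod.elem_tensor_mem[OF mem] by (simp add: bimodule_iso_def)
  \<comment> \<open>On elementary tensors the inner product depends on the factors alone, so it may
    be computed with \<open>edge_product\<close> in place of U.\<close>
  also have "\<dots> = binner (ck_bimodule K) (edge_product (point_mass l) (point_mass k)) (edge_product x y)"
    by (simp add: prod.tensor_inner_elem mem x y edge_product_inner)
  also have "edge_product (point_mass l) (point_mass k) = point_mass (f (l, k))"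
    using lk by (subst edge_product_point_mass) (auto simp: pairs_iff)
  finally show "U (?e x y) (f (l, k)) = x l * y k"
    using K.binner_point_mass[OF f_closed[OF lk]] by (metis edge_product_f lk)
qed

end

section \<open>The product system of a product system of graphs\<close>

context graph_product_system
begin

lemma edge_factorisation: "edge_factorisation (E p) (E q) (E (p * q)) (\<phi> p q) V"
  by (intro edge_factorisation.intro edge_factorisation_axioms.intro graph verts iso)

text \<open>The locale constant as a function of the degrees, so that products over different pairs
  of degrees can occur in one statement.\<close>

definition fibre_mult :: "'p \<Rightarrow> 'p \<Rightarrow> ('v \<Rightarrow> complex) \<Rightarrow> ('v \<Rightarrow> complex) \<Rightarrow> 'v \<Rightarrow> complex" where
  "fibre_mult p q = edge_factorisation.edge_product (E p) (E q) (E (p * q)) (\<phi> p q)"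

definition total_mult :: "'p \<times> ('v \<Rightarrow> complex) \<Rightarrow> 'p \<times> ('v \<Rightarrow> complex) \<Rightarrow> 'p \<times> ('v \<Rightarrow> complex)" where
  "total_mult \<xi> \<eta> = (fst \<xi> * fst \<eta>, fibre_mult (fst \<xi>) (fst \<eta>) (snd \<xi>) (snd \<eta>))"

lemmas phi_closed = edge_factorisation.f_closed[OF edge_factorisation]
  and phi_eq_iff = edge_factorisation.f_eq_iff[OF edge_factorisation]
  and tail_phi = edge_factorisation.tail_f[OF edge_factorisation]
  and head_phi = edge_factorisation.head_f[OF edge_factorisation]
  and phi_cases = edge_factorisation.edge_cases[OF edge_factorisation]
  and fibre_mult_phi = edge_factorisation.edge_product_f[OF edge_factorisation, folded fibre_mult_def]
  and fibre_mult_eqI = edge_factorisation.edge_product_eqI[OF edge_factorisation, folded fibre_mult_def]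
  and fibre_mult_outside = edge_factorisation.edge_product_outside[OF edge_factorisation, folded fibre_mult_def]

lemma pairs_iff: "(l, k) \<in> arcs (fibre_product (E p) (E q)) \<longleftrightarrow>
    l \<in> arcs (E p) \<and> k \<in> arcs (E q) \<and> head (E p) l = tail (E q) k"
  by (simp add: fibre_product_def)

lemma tail_in_V: "l \<in> arcs (E p) \<Longrightarrow> tail (E p) l \<in> V"
  and head_in_V: "l \<in> arcs (E p) \<Longrightarrow> head (E p) l \<in> V"
  using wf_digraph.tail_in_verts[OF graph] wf_digraph.head_in_verts[OF graph] by (auto simp: verts)

text \<open>
  That the identities of the vertices act trivially is not an axiom. The map
  \<open>l \<mapsto> \<phi> 1 p (tail l, l)\<close> is idempotent by associativity and injective, hence the identity.
\<close>

lemma phi_one_one: "v \<in> V \<Longrightarrow> \<phi> 1 1 (v, v) = v"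
  using phi_closed[of v v 1 1] tail_phi[of v v 1 1] tail_one
  by (simp add: pairs_iff arcs_one head_one)

lemma phi_one_left:
  assumes l: "l \<in> arcs (E p)"
  shows "\<phi> 1 p (tail (E p) l, l) = l"
proof -
  define v where "v = tail (E p) l"
  have v: "v \<in> V" using l by (simp add: v_def tail_in_V)
  have vl: "(v, l) \<in> arcs (fibre_product (E 1) (E p))"
    using v l by (simp add: pairs_iff arcs_one head_one v_def)
  have "\<phi> 1 p (v, l) \<in> arcs (E p)" "tail (E p) (\<phi> 1 p (v, l)) = v"
    using phi_closed[OF vl] tail_phi[OF vl] v by (simp_all add: tail_one)
  then have vm: "(v, \<phi> 1 p (v, l)) \<in> arcs (fibre_product (E 1) (E p))"
    using v by (simp add: pairs_iff arcs_one head_one)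
  have "(v, v) \<in> arcs (fibre_product (E 1) (E 1))"
    using v by (simp add: pairs_iff arcs_one head_one tail_one)
  \<comment> \<open>Associativity for v, v, l reads (vv)l = v(vl), and vv = v. Injectivity on
    composable pairs then cancels the outer v.\<close>
  then have "\<phi> 1 p (v, l) = \<phi> 1 p (v, \<phi> 1 p (v, l))"
    using assoc[of v v 1 1 l p] vl phi_one_one[OF v] by simp
  then show ?thesis using phi_eq_iff[OF vl vm] by (simp add: v_def)
qed

lemma phi_one_right:
  assumes l: "l \<in> arcs (E p)"
  shows "\<phi> p 1 (l, head (E p) l) = l"
proof -
  define v where "v = head (E p) l"
  have v: "v \<in> V" using l by (simp add: v_def head_in_V)
  have lv: "(l, v) \<in> arcs (fibre_product (E p) (E 1))"
    using v l by (simp add: pairs_iff arcs_one tail_one v_def)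
  have "\<phi> p 1 (l, v) \<in> arcs (E p)" "head (E p) (\<phi> p 1 (l, v)) = v"
    using phi_closed[OF lv] head_phi[OF lv] v by (simp_all add: head_one)
  then have mv: "(\<phi> p 1 (l, v), v) \<in> arcs (fibre_product (E p) (E 1))"
    using v by (simp add: pairs_iff arcs_one tail_one)
  have "(v, v) \<in> arcs (fibre_product (E 1) (E 1))"
    using v by (simp add: pairs_iff arcs_one head_one tail_one)
  then have "\<phi> p 1 (\<phi> p 1 (l, v), v) = \<phi> p 1 (l, v)"
    using assoc[of l v p 1 v 1] lv phi_one_one[OF v] by simp
  then show ?thesis using phi_eq_iff[OF mv lv] by (simp add: v_def)
qed

lemma fibre_mult_one_left: "x \<in> bcarrier (ck_bimodule (E p)) \<Longrightarrow> fibre_mult 1 p a x = bleft (ck_bimodule (E p)) a x"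
proof (rule fibre_mult_eqI)
  fix v l assume vl: "(v, l) \<in> arcs (fibre_product (E 1) (E p))"
  then have "v = tail (E p) l" "l \<in> arcs (E p)" by (auto simp: pairs_iff arcs_one head_one)
  then show "bleft (ck_bimodule (E p)) a x (\<phi> 1 p (v, l)) = a v * x l"
    by (simp add: phi_one_left ck_simps)
qed (simp add: ck_simps wf_digraph.ckD(1)[OF graph])

lemma fibre_mult_one_right: "x \<in> bcarrier (ck_bimodule (E p)) \<Longrightarrow> fibre_mult p 1 x a = bright (ck_bimodule (E p)) x a"
proof (rule fibre_mult_eqI)
  fix l v assume lv: "(l, v) \<in> arcs (fibre_product (E p) (E 1))"
  then have "v = head (E p) l" "l \<in> arcs (E p)" by (auto simp: pairs_iff arcs_one tail_one)
  then show "bright (ck_bimodule (E p)) x a (\<phi> p 1 (l, v)) = x l * a v"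
    by (simp add: phi_one_right ck_simps)
qed (simp add: ck_simps wf_digraph.ckD(1)[OF graph])

text \<open>Each coefficient is a single product of values, with no sum to rearrange, so the
  identity holds for arbitrary functions. At the edge (lk)j = l(kj) both sides are the product of x
  l, y k and z j.\<close>

lemma fibre_mult_assoc: "fibre_mult (p * q) r (fibre_mult p q x y) z = fibre_mult p (q * r) x (fibre_mult q r y z)"
proof (rule fibre_mult_eqI)
  fix n assume "n \<notin> arcs (E (p * q * r))"
  then show "fibre_mult p (q * r) x (fibre_mult q r y z) n = 0"
    by (intro fibre_mult_outside) (simp add: mult.assoc)
next
  fix m j assume mj: "(m, j) \<in> arcs (fibre_product (E (p * q)) (E r))"
  then have "m \<in> arcs (E (p * q))" by (simp add: pairs_iff)
  then obtain l k where m: "m = \<phi> p q (l, k)" and lk: "(l, k) \<in> arcs (fibre_product (E p) (E q))"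
    by (rule phi_cases)
  have kj: "(k, j) \<in> arcs (fibre_product (E q) (E r))"
    using mj lk head_phi[OF lk] by (simp add: m pairs_iff)
  have lkj: "(l, \<phi> q r (k, j)) \<in> arcs (fibre_product (E p) (E (q * r)))"
    using lk phi_closed[OF kj] tail_phi[OF kj] by (simp add: pairs_iff)
  have "fibre_mult p (q * r) x (fibre_mult q r y z) (\<phi> (p * q) r (m, j)) = x l * (y k * z j)"
    unfolding m assoc[OF lk kj] by (simp add: fibre_mult_phi lkj kj)
  then show "fibre_mult p (q * r) x (fibre_mult q r y z) (\<phi> (p * q) r (m, j)) = fibre_mult p q x y m * z j"
    by (simp add: m fibre_mult_phi lk)
qed

section \<open>The fibre over the identity\<close>

lemma in_arcs_one: "in_arcs (E 1) v = (if v \<in> V then {v} else {})"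
  by (auto simp: in_arcs_def arcs_one head_one)

text \<open>The only edge of \<open>E 1\<close> into v is v itself, so <x, x> at v is the square of
  |x v|. Squaring does not affect vanishing at infinity: the thresholds \<epsilon> and \<epsilon>^2,
  or sqrt \<epsilon> and \<epsilon>, correspond.\<close>

lemma ck_carrier_one: "bcarrier (ck_bimodule (E 1)) = alg (C0 V)"
proof -
  have sq: "ck_sq (E 1) x v = (cmod (x v))\<^sup>2" if "v \<in> V" for x v
    using that by (simp add: ck_sq_def in_arcs_one)
  have fin: "x sq_summable_on in_arcs (E 1) v" for x v
    by (simp add: in_arcs_one)
  have "vanishes_at_infinity V (ck_sq (E 1) x) \<longleftrightarrow> vanishes_at_infinity V x" for x
  proof
    assume *: "vanishes_at_infinity V (ck_sq (E 1) x)"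
    show "vanishes_at_infinity V x"
      unfolding vanishes_at_infinity_def
    proof (intro allI impI)
      fix \<epsilon> :: real assume \<epsilon>: "\<epsilon> > 0"
      have "{v \<in> V. cmod (x v) \<ge> \<epsilon>} \<subseteq> {v \<in> V. norm (ck_sq (E 1) x v) \<ge> \<epsilon>\<^sup>2}"
        using \<epsilon> by (auto simp: sq intro: power_mono)
      then show "finite {v \<in> V. cmod (x v) \<ge> \<epsilon>}"
        by (rule finite_subset) (rule vanishes_at_infinityD[OF *], use \<epsilon> in simp)
    qed
  next
    assume *: "vanishes_at_infinity V x"
    show "vanishes_at_infinity V (ck_sq (E 1) x)"
      unfolding vanishes_at_infinity_def
    proof (intro allI impI)
      fix \<epsilon> :: real assume \<epsilon>: "\<epsilon> > 0"
      have "{v \<in> V. norm (ck_sq (E 1) x v) \<ge> \<epsilon>} \<subseteq> {v \<in> V. cmod (x v) \<ge> sqrt \<epsilon>}"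
        by (auto simp: sq intro: real_le_lsqrt)
      then show "finite {v \<in> V. norm (ck_sq (E 1) x v) \<ge> \<epsilon>}"
        by (rule finite_subset) (rule vanishes_at_infinityD[OF *], use \<epsilon> in simp)
    qed
  qed
  then show ?thesis
    by (auto simp: C0_iff wf_digraph.ck_iff[OF graph] verts fin arcs_one)
qed

lemma self_bimodule_iso_one: "bimodule_iso (C0 V) (self_bimodule (C0 V)) (ck_bimodule (E 1)) (\<lambda>a. a)"
proof -
  have "(\<lambda>l. x l * a (head (E 1) l)) = x * a" "(\<lambda>l. a (tail (E 1) l) * x l) = a * x"
    if "x \<in> alg (C0 V)" for x a :: "'v \<Rightarrow> complex"
  proof -
    \<comment> \<open>Outside V the maps \<open>head\<close> and \<open>tail\<close> have no
      prescribed values; both sides are 0 there because x is.\<close>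
    have "x l * a l = x l * a (head (E 1) l)" "a l * x l = a (tail (E 1) l) * x l" for l
      using that by (cases "l \<in> V"; simp add: head_one tail_one C0_iff)+
    then show "(\<lambda>l. x l * a (head (E 1) l)) = x * a" "(\<lambda>l. a (tail (E 1) l) * x l) = a * x"
      by (simp_all only: fun_eq_iff times_fun_apply simp_thms)
  qed
  moreover have "(\<lambda>v. \<Sum>\<^sub>\<infinity>l\<in>in_arcs (E 1) v. cnj (x l) * y l) = astar (C0 V) x * y"
    if "x \<in> alg (C0 V)" for x y
    using that by (auto simp: fun_eq_iff in_arcs_one C0_simps C0_iff)
  ultimately show ?thesis
    by (simp add: bimodule_iso_def self_bimodule_def ck_carrier_one ck_simps C0_simps(1) bij_betw_id[unfolded id_def])
qed

section \<open>Existence and uniqueness of the multiplication\<close>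

theorem bimodule_product_system_total_mult:
  "bimodule_product_system (C0 V) (\<lambda>p. ck_bimodule (E p)) total_mult"
proof (rule bimodule_product_system.intro)
  show "hilbert_bimodule (C0 V) (ck_bimodule (E p))" for p
    using wf_digraph.hilbert_bimodule_ck[OF graph] by (simp add: verts)
  show "bimodule_iso (C0 V) (self_bimodule (C0 V)) (ck_bimodule (E 1)) (\<lambda>a. a)"
    by (rule self_bimodule_iso_one)
  show "total_mult (p, x) (q, y) \<in> {p * q} \<times> bcarrier (ck_bimodule (E (p * q)))"
    if "x \<in> bcarrier (ck_bimodule (E p))" "y \<in> bcarrier (ck_bimodule (E q))" for x y p q
    using edge_factorisation.edge_product_closed[OF edge_factorisation that]
    by (simp add: total_mult_def fibre_mult_def)
  show "total_mult (total_mult \<xi> \<eta>) \<zeta> = total_mult \<xi> (total_mult \<eta> \<zeta>)" for \<xi> \<eta> \<zeta>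
    by (simp add: total_mult_def fibre_mult_assoc mult.assoc)
  show "\<exists>U. bimodule_iso (C0 V) (tensor (C0 V) (ck_bimodule (E p)) (ck_bimodule (E q))) (ck_bimodule (E (p * q))) U \<and>
      (\<forall>x\<in>bcarrier (ck_bimodule (E p)). \<forall>y\<in>bcarrier (ck_bimodule (E q)).
        total_mult (p, x) (q, y) = (p * q, U (elem_tensor (C0 V) (ck_bimodule (E p)) (ck_bimodule (E q)) x y)))" for p q
  proof -
    interpret F: edge_factorisation "E p" "E q" "E (p * q)" "\<phi> p q" V by (rule edge_factorisation)
    show ?thesis using F.prod.tensor_iso by (auto simp: total_mult_def fibre_mult_def)
  qed
qed (simp_all add: total_mult_def fibre_mult_one_left fibre_mult_one_right)

lemma degree_eq: "l \<in> arcs (E p) \<Longrightarrow> degree E l = p"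
  unfolding degree_def using arcs_disjoint by blast

theorem point_mass_rule_total_mult: "point_mass_rule E \<phi> total_mult"
  unfolding point_mass_rule_def all_arcs_def
  using edge_factorisation.edge_product_point_mass[OF edge_factorisation]
  by (auto simp: degree_eq total_mult_def fibre_mult_def)

text \<open>The tensor axiom speaks only of degrees other than 1. When p or q is 1, the element of
  that fibre lies in the coefficient algebra by \<open>ck_carrier_one\<close>, and the axiom on the
  left or right action forces the product. Otherwise the point mass rule fixes U on the elementary
  tensors of composable point masses, and \<open>tensor_image_eq\<close> does the rest.\<close>

theorem total_mult_unique:
  assumes m: "bimodule_product_system (C0 V) (\<lambda>p. ck_bimodule (E p)) m" "point_mass_rule E \<phi> m"
    and x: "x \<in> bcarrier (ck_bimodule (E p))" and y: "y \<in> bcarrier (ck_bimodule (E q))"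
  shows "m (p, x) (q, y) = total_mult (p, x) (q, y)"
proof -
  interpret M: bimodule_product_system "C0 V" "\<lambda>p. ck_bimodule (E p)" m by (rule m(1))
  consider "p = 1" | "q = 1" | "p \<noteq> 1" "q \<noteq> 1" by blast
  then show ?thesis
  proof cases
    case 1
    then show ?thesis
      using M.mult_one_left[of x y q] x y by (simp add: total_mult_def fibre_mult_one_left ck_carrier_one)
  next
    case 2
    then show ?thesis
      using M.mult_one_right[of y x p] x y by (simp add: total_mult_def fibre_mult_one_right ck_carrier_one)
  next
    case 3
    let ?e = "elem_tensor (C0 V) (ck_bimodule (E p)) (ck_bimodule (E q))"
    interpret F: edge_factorisation "E p" "E q" "E (p * q)" "\<phi> p q" V by (rule edge_factorisation)
    obtain U where U: "bimodule_iso (C0 V) (tensor (C0 V) (ck_bimodule (E p)) (ck_bimodule (E q))) (ck_bimodule (E (p * q))) U"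
      and mU: "\<And>x y. x \<in> bcarrier (ck_bimodule (E p)) \<Longrightarrow> y \<in> bcarrier (ck_bimodule (E q)) \<Longrightarrow>
        m (p, x) (q, y) = (p * q, U (?e x y))"
      using M.mult_tensor[OF 3] by blast
    have "U (?e (point_mass l) (point_mass k)) = point_mass (\<phi> p q (l, k))"
      if lk: "(l, k) \<in> arcs (fibre_product (E p) (E q))" for l k
    proof -
      have arc: "l \<in> arcs (E p)" "k \<in> arcs (E q)" using lk by (auto simp: pairs_iff)
      then have mem: "l \<in> all_arcs E" "k \<in> all_arcs E" by (auto simp: all_arcs_def)
      have "m (p, point_mass l) (q, point_mass k) = (p * q, point_mass (\<phi> p q (l, k)))"
        using bspec[OF bspec[OF m(2)[unfolded point_mass_rule_def] mem(1)] mem(2)] lk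
        by (simp add: degree_eq[OF arc(1)] degree_eq[OF arc(2)])
      then show ?thesis
        using mU[OF wf_digraph.point_mass_mem[OF graph arc(1)] wf_digraph.point_mass_mem[OF graph arc(2)]] by simp
    qed
    then have "U (?e x y) = F.edge_product x y"
      by (rule F.tensor_image_eq[OF U _ x y])
    then show ?thesis using mU[OF x y] by (simp add: total_mult_def fibre_mult_def)
  qed
qed

end

text \<open>Multiplications are compared on the total space because the axioms say nothing about
  arguments outside the carriers.\<close>

theorem proposition3p2:
  fixes V :: "'v set"
    and E :: "'p::{monoid_mult, countable} \<Rightarrow> ('v, 'v) pre_digraph"
    and \<phi> :: "'p \<Rightarrow> 'p \<Rightarrow> 'v \<times> 'v \<Rightarrow> 'v"
  assumes "graph_product_system V E \<phi>"
  shows "\<exists>m. bimodule_product_system (C0 V) (\<lambda>p. ck_bimodule (E p)) m \<and> point_mass_rule E \<phi> m \<and>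
    (\<forall>m'. bimodule_product_system (C0 V) (\<lambda>p. ck_bimodule (E p)) m' \<and> point_mass_rule E \<phi> m' \<longrightarrow>
      (\<forall>\<xi>\<in>total_space (\<lambda>p. ck_bimodule (E p)). \<forall>\<eta>\<in>total_space (\<lambda>p. ck_bimodule (E p)).
         m' \<xi> \<eta> = m \<xi> \<eta>))"
proof -
  interpret graph_product_system V E \<phi> by (rule assms)
  show ?thesis
  proof (intro exI conjI allI impI ballI)
    fix m' \<xi> \<eta>
    assume m': "bimodule_product_system (C0 V) (\<lambda>p. ck_bimodule (E p)) m' \<and> point_mass_rule E \<phi> m'"
      and "\<xi> \<in> total_space (\<lambda>p. ck_bimodule (E p))" "\<eta> \<in> total_space (\<lambda>p. ck_bimodule (E p))"
    then obtain p x q y where "\<xi> = (p, x)" "\<eta> = (q, y)"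
        "x \<in> bcarrier (ck_bimodule (E p))" "y \<in> bcarrier (ck_bimodule (E q))"
      by (auto simp: total_space_def)
    then show "m' \<xi> \<eta> = total_mult \<xi> \<eta>"
      using total_mult_unique[of m'] m' by simp
  qed (rule bimodule_product_system_total_mult, rule point_mass_rule_total_mult)
qed

end
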